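(* Let $A$ be a unital generalized Poisson algebra over a field of characteristic zero. If $A$ satisfies a polynomial identity $g_0$ (nonzero as an element of a free unital generalized Poisson algebra), then $A$ satisfies, for some $m\ge 1$, a nontrivial polynomial identity $g_*=0$ of the form $$g_*=\sum_{i=0}^{[m/2]}\sum_{\sigma\in S_m}c_{\sigma,i}\,\langle x_{\sigma(1)},x_{\sigma(2)}\rangle\cdots\langle x_{\sigma(2i-1)},x_{\sigma(2i)}\rangle\, D(x_{\sigma(2i+1)})\cdots D(x_{\sigma(m)}),$$ where the $c_{\sigma,i}$ are scalars, $D(x)=\{x,1\}$ and $\langle x,y\rangle=\{x,y\}-(D(x)y-xD(y))$.
   Context: A unital generalized Poisson algebra is a vector space $A$ with an associative commutative product $\cdot$ with unit $1$ and an anticommutative bracket $\{,\}$ such that, with $D(a)=\{a,1\}$, $$\{a,bc\}=\{a,b\}c+b\{a,c\}-D(a)bc,\qquad \{a,\{b,c\}\}=\{\{a,b\},c\}+\{b,\{a,c\}\}$$ for all $a,b,c\in A$. A polynomial identity of $A$ is an element $f(x_1,\dots,x_n)$ of the free unital generalized Poisson algebra generated by $x_1,\dots,x_n$ and the unit $1$ such that $f(a_1,\dots,a_n)=0$ for all $a_1,\dots,a_n\in A$. It is nontrivial if $f\neq 0$ in the free algebra. *)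

theory Defs
  imports Complex_Main "HOL-Combinatorics.Permutations"
begin

text \<open>
  The sort \<open>{comm_ring, comm_monoid_mult}\<close> is that of commutative associative rings with a
  unit; unlike \<open>comm_ring_1\<close> it does not demand \<open>0 \<noteq> 1\<close>, so the zero algebra is included.
  Linearity of the bracket in the second argument follows from linearity in the first one
  and anticommutativity.
\<close>

locale unital_gpa = vector_space scale
  for scale :: "'k::field \<Rightarrow> 'a::{comm_ring,comm_monoid_mult} \<Rightarrow> 'a" +
  fixes bracket :: "'a \<Rightarrow> 'a \<Rightarrow> 'a"
  assumes scale_mult: "scale c (a * b) = scale c a * b"
    and bracket_add: "bracket (a + b) d = bracket a d + bracket b d"
    and bracket_scale: "bracket (scale c a) b = scale c (bracket a b)"
    and bracket_anticomm: "bracket a b = - bracket b a"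
    and bracket_mult:
      "bracket a (b * d) = bracket a b * d + b * bracket a d - bracket a 1 * b * d"
    and bracket_jacobi:
      "bracket a (bracket b d) = bracket (bracket a b) d + bracket b (bracket a d)"
begin

definition D :: "'a \<Rightarrow> 'a" where
  "D a = bracket a 1"

definition angle :: "'a \<Rightarrow> 'a \<Rightarrow> 'a" where
  "angle a b = bracket a b - (D a * b - a * D b)"

end

text \<open>
  The free algebra over the field \<open>'k\<close> on the set of generators \<open>'v\<close> is the algebra of
  terms in the signature of unital generalized Poisson algebras, modulo the least congruence
  that contains all instances of the axioms.
\<close>

datatype ('k, 'v) gpa_term =
    TVar 'v
  | TZero
  | TOne
  | TAdd "('k, 'v) gpa_term" "('k, 'v) gpa_term"
  | TNeg "('k, 'v) gpa_term"
  | TScale 'k "('k, 'v) gpa_term"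
  | TMult "('k, 'v) gpa_term" "('k, 'v) gpa_term"
  | TBracket "('k, 'v) gpa_term" "('k, 'v) gpa_term"

inductive gpa_eq :: "('k::field, 'v) gpa_term \<Rightarrow> ('k, 'v) gpa_term \<Rightarrow> bool" where
  refl: "gpa_eq s s"
| sym: "gpa_eq s t \<Longrightarrow> gpa_eq t s"
| trans: "gpa_eq s t \<Longrightarrow> gpa_eq t u \<Longrightarrow> gpa_eq s u"
| cong_add: "gpa_eq s s' \<Longrightarrow> gpa_eq t t' \<Longrightarrow> gpa_eq (TAdd s t) (TAdd s' t')"
| cong_neg: "gpa_eq s s' \<Longrightarrow> gpa_eq (TNeg s) (TNeg s')"
| cong_scale: "gpa_eq s s' \<Longrightarrow> gpa_eq (TScale c s) (TScale c s')"
| cong_mult: "gpa_eq s s' \<Longrightarrow> gpa_eq t t' \<Longrightarrow> gpa_eq (TMult s t) (TMult s' t')"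
| cong_bracket: "gpa_eq s s' \<Longrightarrow> gpa_eq t t' \<Longrightarrow> gpa_eq (TBracket s t) (TBracket s' t')"
| add_assoc: "gpa_eq (TAdd (TAdd s t) u) (TAdd s (TAdd t u))"
| add_comm: "gpa_eq (TAdd s t) (TAdd t s)"
| add_zero: "gpa_eq (TAdd TZero s) s"
| add_neg: "gpa_eq (TAdd (TNeg s) s) TZero"
| scale_add_right: "gpa_eq (TScale c (TAdd s t)) (TAdd (TScale c s) (TScale c t))"
| scale_add_left: "gpa_eq (TScale (c + d) s) (TAdd (TScale c s) (TScale d s))"
| scale_scale: "gpa_eq (TScale c (TScale d s)) (TScale (c * d) s)"
| scale_one: "gpa_eq (TScale 1 s) s"
| mult_assoc: "gpa_eq (TMult (TMult s t) u) (TMult s (TMult t u))"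
| mult_comm: "gpa_eq (TMult s t) (TMult t s)"
| mult_one: "gpa_eq (TMult TOne s) s"
| mult_add: "gpa_eq (TMult (TAdd s t) u) (TAdd (TMult s u) (TMult t u))"
| mult_scale: "gpa_eq (TScale c (TMult s t)) (TMult (TScale c s) t)"
| bracket_add: "gpa_eq (TBracket (TAdd s t) u) (TAdd (TBracket s u) (TBracket t u))"
| bracket_scale: "gpa_eq (TBracket (TScale c s) t) (TScale c (TBracket s t))"
| bracket_anticomm: "gpa_eq (TBracket s t) (TNeg (TBracket t s))"
| bracket_mult: "gpa_eq (TBracket s (TMult t u))
    (TAdd (TAdd (TMult (TBracket s t) u) (TMult t (TBracket s u)))
          (TNeg (TMult (TMult (TBracket s TOne) t) u)))"
| bracket_jacobi: "gpa_eq (TBracket s (TBracket t u))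
    (TAdd (TBracket (TBracket s t) u) (TBracket t (TBracket s u)))"

quotient_type (overloaded) ('k, 'v) free_gpa = "('k::field, 'v) gpa_term" / gpa_eq
proof (rule equivpI)
  show "reflp gpa_eq" by (simp add: reflpI gpa_eq.refl)
  show "symp gpa_eq" by (simp add: sympI gpa_eq.sym)
  show "transp gpa_eq" by (rule transpI) (rule gpa_eq.trans)
qed

lift_definition gen :: "'v \<Rightarrow> ('k::field, 'v) free_gpa" is TVar .

lift_definition free_scale :: "'k::field \<Rightarrow> ('k, 'v) free_gpa \<Rightarrow> ('k, 'v) free_gpa"
  is TScale by (rule gpa_eq.cong_scale)

lift_definition free_bracket ::
    "('k::field, 'v) free_gpa \<Rightarrow> ('k, 'v) free_gpa \<Rightarrow> ('k, 'v) free_gpa"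
  is TBracket by (rule gpa_eq.cong_bracket)

instantiation free_gpa :: (field, type) "{comm_ring, comm_monoid_mult}"
begin

lift_definition zero_free_gpa :: "('a, 'b) free_gpa" is TZero .
lift_definition one_free_gpa :: "('a, 'b) free_gpa" is TOne .
lift_definition plus_free_gpa ::
    "('a, 'b) free_gpa \<Rightarrow> ('a, 'b) free_gpa \<Rightarrow> ('a, 'b) free_gpa"
  is TAdd by (rule gpa_eq.cong_add)
lift_definition uminus_free_gpa :: "('a, 'b) free_gpa \<Rightarrow> ('a, 'b) free_gpa"
  is TNeg by (rule gpa_eq.cong_neg)
lift_definition minus_free_gpa ::
    "('a, 'b) free_gpa \<Rightarrow> ('a, 'b) free_gpa \<Rightarrow> ('a, 'b) free_gpa"
  is "\<lambda>s t. TAdd s (TNeg t)" by (intro gpa_eq.cong_add gpa_eq.cong_neg)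
lift_definition times_free_gpa ::
    "('a, 'b) free_gpa \<Rightarrow> ('a, 'b) free_gpa \<Rightarrow> ('a, 'b) free_gpa"
  is TMult by (rule gpa_eq.cong_mult)

instance
proof
  fix a b c :: "('a, 'b) free_gpa"
  show "a + b + c = a + (b + c)" by transfer (rule gpa_eq.add_assoc)
  show "a + b = b + a" by transfer (rule gpa_eq.add_comm)
  show "0 + a = a" by transfer (rule gpa_eq.add_zero)
  show "- a + a = 0" by transfer (rule gpa_eq.add_neg)
  show "a - b = a + - b" by transfer (rule gpa_eq.refl)
  show "a * b * c = a * (b * c)" by transfer (rule gpa_eq.mult_assoc)
  show "a * b = b * a" by transfer (rule gpa_eq.mult_comm)
  show "1 * a = a" by transfer (rule gpa_eq.mult_one)
  show "(a + b) * c = a * c + b * c" by transfer (rule gpa_eq.mult_add)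
qed

end

global_interpretation free: unital_gpa free_scale free_bracket
proof
  fix a b d :: "('k::field, 'v) free_gpa" and c c' :: 'k
  show "free_scale c (a + b) = free_scale c a + free_scale c b"
    by transfer (rule gpa_eq.scale_add_right)
  show "free_scale (c + c') a = free_scale c a + free_scale c' a"
    by transfer (rule gpa_eq.scale_add_left)
  show "free_scale c (free_scale c' a) = free_scale (c * c') a"
    by transfer (rule gpa_eq.scale_scale)
  show "free_scale 1 a = a"
    by transfer (rule gpa_eq.scale_one)
  show "free_scale c (a * b) = free_scale c a * b"
    by transfer (rule gpa_eq.mult_scale)
  show "free_bracket (a + b) d = free_bracket a d + free_bracket b d"
    by transfer (rule gpa_eq.bracket_add)
  show "free_bracket (free_scale c a) b = free_scale c (free_bracket a b)"
    by transfer (rule gpa_eq.bracket_scale)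
  show "free_bracket a b = - free_bracket b a"
    by transfer (rule gpa_eq.bracket_anticomm)
  show "free_bracket a (b * d) =
      free_bracket a b * d + b * free_bracket a d - free_bracket a 1 * b * d"
    by transfer (rule gpa_eq.bracket_mult)
  show "free_bracket a (free_bracket b d) =
      free_bracket (free_bracket a b) d + free_bracket b (free_bracket a d)"
    by transfer (rule gpa_eq.bracket_jacobi)
qed

lemma free_gpa_induct [case_names gen zero one add neg scale mult bracket]:
  assumes "\<And>v. P (gen v)" and "P 0" and "P 1"
    and "\<And>f g. P f \<Longrightarrow> P g \<Longrightarrow> P (f + g)" and "\<And>f. P f \<Longrightarrow> P (- f)"
    and "\<And>c f. P f \<Longrightarrow> P (free_scale c f)"
    and "\<And>f g. P f \<Longrightarrow> P g \<Longrightarrow> P (f * g)"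
    and "\<And>f g. P f \<Longrightarrow> P g \<Longrightarrow> P (free_bracket f g)"
  shows "P (f :: ('k::field, 'v) free_gpa)"
proof -
  have "P (abs_free_gpa t)" for t
    by (induction t)
      (use assms in \<open>simp_all flip: gen.abs_eq zero_free_gpa.abs_eq one_free_gpa.abs_eq
        plus_free_gpa.abs_eq uminus_free_gpa.abs_eq free_scale.abs_eq
        times_free_gpa.abs_eq free_bracket.abs_eq\<close>)
  then show ?thesis by (metis Quotient_free_gpa Quotient_abs_rep)
qed

context unital_gpa
begin

primrec eval_term :: "('v \<Rightarrow> 'a) \<Rightarrow> ('k, 'v) gpa_term \<Rightarrow> 'a" where
  "eval_term a (TVar v) = a v"
| "eval_term a TZero = 0"
| "eval_term a TOne = 1"
| "eval_term a (TAdd s t) = eval_term a s + eval_term a t"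
| "eval_term a (TNeg s) = - eval_term a s"
| "eval_term a (TScale c s) = scale c (eval_term a s)"
| "eval_term a (TMult s t) = eval_term a s * eval_term a t"
| "eval_term a (TBracket s t) = bracket (eval_term a s) (eval_term a t)"

lemma eval_term_cong: "gpa_eq s t \<Longrightarrow> eval_term a s = eval_term a t"
proof -
  note anticomm = bracket_anticomm and leibniz = bracket_mult and jacobi = bracket_jacobi
  show "gpa_eq s t \<Longrightarrow> eval_term a s = eval_term a t"
  proof (induction rule: gpa_eq.induct)
    case (bracket_anticomm s t)
    show ?case unfolding eval_term.simps by (rule anticomm)
  next
    case (bracket_mult s t u)
    show ?case by (simp add: leibniz)
  next
    case (bracket_jacobi s t u)
    show ?case unfolding eval_term.simps by (rule jacobi)
  qed (simp_all add: algebra_simps scale_mult bracket_add bracket_scale)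
qed

definition eval :: "('v \<Rightarrow> 'a) \<Rightarrow> ('k, 'v) free_gpa \<Rightarrow> 'a" where
  "eval a f = eval_term a (rep_free_gpa f)"

lemma eval_abs: "eval a (abs_free_gpa t) = eval_term a t"
  unfolding eval_def
  by (intro eval_term_cong) (metis Quotient_free_gpa Quotient_rep_abs gpa_eq.refl)

lemma eval_simps [simp]:
  "eval a (gen v) = a v"
  "eval a 0 = 0"
  "eval a 1 = 1"
  "eval a (f + g) = eval a f + eval a g"
  "eval a (- f) = - eval a f"
  "eval a (f - g) = eval a f - eval a g"
  "eval a (free_scale c f) = scale c (eval a f)"
  "eval a (f * g) = eval a f * eval a g"
  "eval a (free_bracket f g) = bracket (eval a f) (eval a g)"
proof -
  obtain s t where st: "f = abs_free_gpa s" "g = abs_free_gpa t"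
    by (metis Quotient_free_gpa Quotient_abs_rep)
  show "eval a (gen v) = a v"
    "eval a 0 = 0"
    "eval a 1 = 1"
    "eval a (f + g) = eval a f + eval a g"
    "eval a (- f) = - eval a f"
    "eval a (f - g) = eval a f - eval a g"
    "eval a (free_scale c f) = scale c (eval a f)"
    "eval a (f * g) = eval a f * eval a g"
    "eval a (free_bracket f g) = bracket (eval a f) (eval a g)"
    by (simp_all add: st gen.abs_eq zero_free_gpa.abs_eq one_free_gpa.abs_eq
        plus_free_gpa.abs_eq uminus_free_gpa.abs_eq minus_free_gpa.abs_eq free_scale.abs_eq
        times_free_gpa.abs_eq free_bracket.abs_eq eval_abs)
qed

text \<open>
  Universal property: \<open>eval a\<close> is the only homomorphism that extends \<open>a\<close>.
\<close>

lemma eval_unique: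
  assumes "\<And>v. h (gen v) = a v" and "h 1 = 1"
    and "\<And>f g. h (f + g) = h f + h g"
    and "\<And>c f. h (free_scale c f) = scale c (h f)"
    and "\<And>f g. h (f * g) = h f * h g"
    and "\<And>f g. h (free_bracket f g) = bracket (h f) (h g)"
  shows "h = eval a"
proof
  fix f
  have zero: "h 0 = 0" using assms(3)[of 0 0] by simp
  have neg: "h (- f) = - h f" for f
    using assms(3)[of "- f" f] zero by (simp add: eq_neg_iff_add_eq_0)
  show "h f = eval a f"
    by (induction f rule: free_gpa_induct) (simp_all add: assms zero neg)
qed

definition polynomial_identity :: "('k, 'v) free_gpa \<Rightarrow> bool" where
  "polynomial_identity f \<longleftrightarrow> (\<forall>a. eval a f = 0)"

end

end

(*
  Work in the free algebra on countably many generators.  Complete linearization (characteristic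
  zero) turns the given identity into a nonzero multilinear identity f.

  As a function of its arguments, f is a multi-differential operator of some total order d, where D
  has order 1 and the angle bracket order 2.  Substituting exp (t x) for each argument x and
  dividing by the product of the exponentials leaves a polynomial of degree at most d in t whose top
  coefficient, the symbol of f, is a polynomial in the D x and the <x, y>.  The coefficients of this
  polynomial are again identities, hence so is the symbol.

  It remains to represent f with a nonzero symbol.  Write f as a combination of D^k(z) g and of
  h with some argument x replaced by <D^k(z), x>, where g and h do not involve the variable z.  The
  symbols of these terms are D(z)^k sym(g) and D(z)^k <z, x> sym(h)(x + z).  If they add up to
  0, then all sym(g) and sym(h) vanish, and by induction on the number of variables f can be
  represented with smaller order.  The independence of the D x and <x, y> is seen in a
  monoid algebra whose basis elements e^u satisfy {e^u, e^v} = B(u, v) e^(u + v + z).  Finally the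
  symbol is linearized in turn.
*)
theory Submission
  imports Defs "HOL-Library.Poly_Mapping" "HOL-Library.Multiset" "HOL-Library.Product_Plus"
    "HOL-Computational_Algebra.Formal_Power_Series" "HOL-Computational_Algebra.Polynomial"
begin

section \<open>Derivations and the angle bracket\<close>

text \<open>The free algebra is given by generators and relations, and no basis of it is
  constructed. That an element is nonzero is therefore certified by evaluating it in a concrete
  algebra, and order and symbol belong to a way of writing an element, not to the element itself.
  This is the obstacle: a nonzero multilinear element may be written with an order that is not
  attained, and then its symbol vanishes and says nothing. So vanishing of the symbol under all
  evaluations has to yield a representation of smaller order. At order 0 it forces the element to be
  0, so the descent from a nonzero element stops at a symbol that does not vanish. The bracket obeys
  the Leibniz rule only up to a correction, whereas \<open>D\<close> is a derivation and
  \<open>angle\<close> is one in each argument. This is why exponentials reproduce themselves, with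
  one factor t for \<open>D\<close> and two for \<open>angle\<close>. The variable t is adjoined by
  passing to power series over the free algebra; an identity survives there coefficientwise because
  it is multilinear.\<close>

locale char0_gpa = unital_gpa scale bracket
  for scale :: "'k::field_char_0 \<Rightarrow> 'a::{comm_ring,comm_monoid_mult} \<Rightarrow> 'a"
    and bracket :: "'a \<Rightarrow> 'a \<Rightarrow> 'a"
begin

lemma mult_scale_right: "a * scale c b = scale c (a * b)"
  by (simp add: scale_mult[of c b a] mult.commute[of a])

lemma scale_as_mult: "scale c a = scale c 1 * a"
  by (simp flip: scale_mult)

lemma double_eq_0:
  fixes a :: 'a
  shows "a + a = 0 \<Longrightarrow> a = 0"
proof -
  assume "a + a = 0"
  then have "scale (1 + 1) a = 0" unfolding scale_left_distrib by simp
  moreover have "(1 + 1 :: 'k) \<noteq> 0" by simp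
  ultimately show "a = 0" unfolding scale_eq_0_iff by blast
qed

lemma bracket_self: "bracket a a = 0"
  by (rule double_eq_0, subst (1) bracket_anticomm) (rule left_minus)

lemma bracket_add_right: "bracket d (a + b) = bracket d a + bracket d b"
  unfolding bracket_anticomm[of d] bracket_add by simp

lemma bracket_scale_right: "bracket b (scale c a) = scale c (bracket b a)"
  unfolding bracket_anticomm[of b] bracket_scale by simp

lemma D_add: "D (a + b) = D a + D b" by (simp add: D_def bracket_add)
lemma D_scale: "D (scale c a) = scale c (D a)" by (simp add: D_def bracket_scale)
lemma D_one: "D 1 = 0" by (simp add: D_def bracket_self)
lemma D_zero: "D 0 = 0" using D_scale[of 0 0] by simp
lemma D_minus: "D (- a) = - D a" using D_add[of "- a" a] by (simp add: D_zero eq_neg_iff_add_eq_0)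
lemma D_diff: "D (a - b) = D a - D b" using D_add[of a "- b"] by (simp add: D_minus)
lemma D_sum: "D (sum f S) = (\<Sum>i\<in>S. D (f i))"
  by (induction S rule: infinite_finite_induct) (simp_all add: D_zero D_add)

lemma bracket_one_left: "bracket 1 a = - D a"
  unfolding D_def by (rule bracket_anticomm)

lemma D_mult: "D (a * b) = D a * b + a * D b"
proof -
  have "D (a * b) = - bracket 1 (a * b)" by (simp add: bracket_one_left)
  also have "\<dots> = D a * b + a * D b"
    unfolding bracket_mult by (simp add: bracket_one_left bracket_self algebra_simps)
  finally show ?thesis .
qed

lemma D_bracket: "D (bracket a b) = bracket (D a) b + bracket a (D b)"
proof -
  have "bracket 1 (bracket a b) = bracket (bracket 1 a) b + bracket a (bracket 1 b)"
    by (rule bracket_jacobi)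
  then have "- D (bracket a b) = bracket (- D a) b + bracket a (- D b)"
    by (simp add: bracket_one_left)
  moreover have "bracket (- D a) b = - bracket (D a) b" "bracket a (- D b) = - bracket a (D b)"
    using bracket_scale[of "-1" "D a" b] bracket_scale_right[of a "-1" "D b"] by simp_all
  ultimately show ?thesis
    by (simp add: eq_neg_iff_add_eq_0 neg_eq_iff_add_eq_0 algebra_simps)
qed

lemma bracket_angle: "bracket a b = angle a b + (D a * b - a * D b)"
  by (simp add: angle_def)

lemma angle_add_left: "angle (a + b) d = angle a d + angle b d"
  by (simp add: angle_def bracket_add D_add algebra_simps)
lemma angle_anticomm: "angle a b = - angle b a"
  unfolding angle_def using bracket_anticomm[of a b] by (simp add: algebra_simps)
lemma angle_add_right: "angle d (a + b) = angle d a + angle d b"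
  by (simp add: angle_def bracket_add_right D_add algebra_simps)
lemma angle_scale_left: "angle (scale c a) b = scale c (angle a b)"
  by (simp add: angle_def bracket_scale D_scale scale_right_diff_distrib scale_mult mult_scale_right)
lemma angle_scale_right: "angle a (scale c b) = scale c (angle a b)"
  by (simp add: angle_def bracket_scale_right D_scale scale_right_diff_distrib scale_mult mult_scale_right)
lemma angle_self: "angle a a = 0"
  by (simp add: angle_def bracket_self mult.commute)
lemma angle_zero [simp]: "angle 0 a = 0" "angle a 0 = 0"
  using angle_scale_left[of 0 0 a] angle_scale_right[of a 0 0] by simp_all
lemma angle_minus: "angle (- a) b = - angle a b" "angle a (- b) = - angle a b"
  using angle_scale_left[of "-1" a b] angle_scale_right[of a "-1" b] by simp_all
lemma angle_diff: "angle (a - b) d = angle a d - angle b d" "angle d (a - b) = angle d a - angle d b"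
  using angle_add_left[of a "- b" d] angle_add_right[of d a "- b"] by (simp_all add: angle_minus)
lemma angle_sum_left: "angle (sum f S) d = (\<Sum>i\<in>S. angle (f i) d)"
  by (induction S rule: infinite_finite_induct) (simp_all add: angle_add_left)
lemma angle_sum_right: "angle d (sum f S) = (\<Sum>i\<in>S. angle d (f i))"
  by (induction S rule: infinite_finite_induct) (simp_all add: angle_add_right)

text \<open>The terms subtracted in \<open>angle\<close> absorb exactly the defect
  \<open>- bracket a 1 * b * d\<close> of the Leibniz rule, so \<open>angle\<close> is a
  biderivation.\<close>

lemma angle_mult_right: "angle a (b * d) = angle a b * d + b * angle a d"
  unfolding angle_def bracket_mult
  by (simp add: D_mult algebra_simps flip: D_def)

lemma angle_mult_left: "angle (b * d) a = angle b a * d + b * angle d a"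
  using angle_mult_right[of a b d] by (simp add: angle_anticomm[of _ a])

lemma angle_one [simp]: "angle 1 a = 0" "angle a 1 = 0"
  by (simp_all add: angle_def D_one bracket_one_left) (simp add: D_def)

lemma D_angle: "D (angle a b) = angle (D a) b + angle a (D b)"
  by (simp add: angle_def D_diff D_mult D_bracket)

text \<open>Unlike in a Poisson algebra, corrections appear. Each has one \<open>D\<close> and one
  \<open>angle\<close>, hence order 3, while the double angles have order 4; the corrections are
  therefore invisible in symbols. The proof expands the three double brackets and lets everything
  else cancel.\<close>

lemma angle_jacobi:
  "angle a (angle b d) = angle (angle a b) d + angle b (angle a d)
     + D a * angle b d - D b * angle a d + D d * angle a b"
proof -
  have J: "bracket a (bracket b d) = bracket (bracket a b) d + bracket b (bracket a d)"
    by (rule bracket_jacobi)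
  have anti: "angle d b = - angle b d" "angle b a = - angle a b" "angle b (D a) = - angle (D a) b"
    by (rule angle_anticomm)+
  have 1: "bracket a (bracket b d) = angle a (angle b d) + angle a (D b) * d + D b * angle a d
      - angle a b * D d - b * angle a (D d)
      + D a * (angle b d + D b * d - b * D d)
      - a * (angle (D b) d + angle b (D d) + D (D b) * d - b * D (D d))"
    by (simp add: bracket_angle angle_add_right angle_diff angle_mult_right D_add D_diff D_mult D_angle algebra_simps)
  have 2: "bracket b (bracket a d) = angle b (angle a d) + angle b (D a) * d + D a * angle b d
      - angle b a * D d - a * angle b (D d)
      + D b * (angle a d + D a * d - a * D d)
      - b * (angle (D a) d + angle a (D d) + D (D a) * d - a * D (D d))"
    by (simp add: bracket_angle angle_add_right angle_diff angle_mult_right D_add D_diff D_mult D_angle algebra_simps)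
  have 3: "bracket (bracket a b) d = angle (angle a b) d + angle (D a) d * b + D a * angle b d
      - angle a d * D b - a * angle (D b) d
      + (angle (D a) b + angle a (D b) + D (D a) * b - a * D (D b)) * d
      - (angle a b + D a * b - a * D b) * D d"
    by (simp add: bracket_angle angle_add_left angle_diff angle_mult_left D_add D_diff D_mult D_angle algebra_simps)
  show ?thesis
    using J unfolding 1 2 3 anti by (simp add: algebra_simps)
qed

end

global_interpretation free: char0_gpa "free_scale :: 'k::field_char_0 \<Rightarrow> _" free_bracket
  ..

context unital_gpa
begin

lemma eval_D [simp]: "eval a (free.D f) = D (eval a f)"
  by (simp add: D_def free.D_def)
lemma eval_angle [simp]: "eval a (free.angle f g) = angle (eval a f) (eval a g)"
  by (simp add: angle_def free.angle_def)
lemma eval_sum: "eval a (sum f S) = (\<Sum>i\<in>S. eval a (f i))"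
  by (induction S rule: infinite_finite_induct) simp_all
lemma eval_eval: "eval a (free.eval s f) = eval (\<lambda>v. eval a (s v)) f"
  by (induction f rule: free_gpa_induct) simp_all
end

lemma eval_gen: "free.eval gen f = f"
  by (induction f rule: free_gpa_induct) simp_all

text \<open>The field with zero bracket is a unital generalized Poisson algebra, and evaluation in
  it separates 0 from 1. The sort is the one assumed by \<open>char0_gpa_fps\<close>.\<close>

instance free_gpa :: (field, type) comm_ring_1
proof
  interpret K: unital_gpa "(*) :: 'a \<Rightarrow> 'a \<Rightarrow> 'a" "\<lambda>_ _. 0"
    by unfold_locales (simp_all add: algebra_simps)
  show "(0::('a, 'b) free_gpa) \<noteq> 1"
    using K.eval_simps(2,3)[of "\<lambda>_. 0"] by (metis zero_neq_one)
qed

context char0_gpa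
begin

lemma bracket_zero [simp]: "bracket 0 a = 0" "bracket a 0 = 0"
  using bracket_scale[of 0 0 a] bracket_scale_right[of a 0 0] by simp_all
lemma bracket_sum_left: "bracket (sum f S) d = (\<Sum>i\<in>S. bracket (f i) d)"
  by (induction S rule: infinite_finite_induct) (simp_all add: bracket_add)
lemma bracket_sum_right: "bracket d (sum f S) = (\<Sum>i\<in>S. bracket d (f i))"
  by (induction S rule: infinite_finite_induct) (simp_all add: bracket_add_right)

lemma identity_eval: "polynomial_identity f \<Longrightarrow> polynomial_identity (free.eval s f)"
  by (simp add: polynomial_identity_def eval_eval)
lemma identity_zero: "polynomial_identity 0"
  by (simp add: polynomial_identity_def)
lemma identity_add: "polynomial_identity f \<Longrightarrow> polynomial_identity g \<Longrightarrow> polynomial_identity (f + g)"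
  by (simp add: polynomial_identity_def)
lemma identity_scale: "polynomial_identity f \<Longrightarrow> polynomial_identity (free_scale c f)"
  by (simp add: polynomial_identity_def)
lemma identity_mult: "polynomial_identity f \<Longrightarrow> polynomial_identity (g * f)"
  by (simp add: polynomial_identity_def)
lemma identity_sum: "(\<And>i. i \<in> S \<Longrightarrow> polynomial_identity (f i)) \<Longrightarrow> polynomial_identity (sum f S)"
  by (induction S rule: infinite_finite_induct) (simp_all add: identity_zero identity_add)
end

section \<open>Symbols of multilinear elements\<close>

definition vsum :: "'v set \<Rightarrow> ('k::field, 'v) free_gpa" where
  "vsum S = (\<Sum>v\<in>S. gen v)"

lemma vsum_simps [simp]: "vsum {} = 0" "vsum {v} = gen v"
  by (simp_all add: vsum_def)

lemma vsum_Un: "finite S \<Longrightarrow> finite T \<Longrightarrow> S \<inter> T = {} \<Longrightarrow> vsum (S \<union> T) = vsum S + vsum T"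
  by (simp add: vsum_def sum.union_disjoint)

text \<open>
  \<open>symbol S d f q\<close>: \<open>f\<close> has a representation, multilinear in the variables \<open>S\<close>, of order at
  most \<open>d\<close>, and \<open>q\<close> is its part of order exactly \<open>d\<close>.  The symbol depends on the representation and
  on \<open>d\<close>: the rule \<open>weaken\<close> says that it is \<open>0\<close> if \<open>d\<close> is not attained.
\<close>

inductive symbol ::
    "'v set \<Rightarrow> nat \<Rightarrow> ('k::field_char_0, 'v) free_gpa \<Rightarrow> ('k, 'v) free_gpa \<Rightarrow> bool" where
  zero: "finite S \<Longrightarrow> symbol S d 0 0"
| one: "symbol {} 0 1 1"
| gen: "symbol {v} 0 (gen v) 1"
| add: "symbol S d f q \<Longrightarrow> symbol S d g r \<Longrightarrow> symbol S d (f + g) (q + r)"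
| scale: "symbol S d f q \<Longrightarrow> symbol S d (free_scale c f) (free_scale c q)"
| mult: "symbol S d f q \<Longrightarrow> symbol T e g r \<Longrightarrow> S \<inter> T = {} \<Longrightarrow>
    symbol (S \<union> T) (d + e) (f * g) (q * r)"
| D: "symbol S d f q \<Longrightarrow> symbol S (Suc d) (free.D f) (free.D (vsum S) * q)"
| angle: "symbol S d f q \<Longrightarrow> symbol T e g r \<Longrightarrow> S \<inter> T = {} \<Longrightarrow>
    symbol (S \<union> T) (Suc (Suc (d + e))) (free.angle f g) (free.angle (vsum S) (vsum T) * (q * r))"
| weaken: "symbol S d f q \<Longrightarrow> symbol S (Suc d) f 0"

lemma symbol_finite: "symbol S d f q \<Longrightarrow> finite S"
  by (induction rule: symbol.induct) auto

context char0_gpa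
begin

lemma symbol_eval_cong:
  "symbol S d f q \<Longrightarrow> (\<And>v. v \<in> S \<Longrightarrow> a v = b v) \<Longrightarrow> eval a f = eval b f"
  by (induction rule: symbol.induct) simp_all

lemma symbol_eval_upd:
  "symbol S d f q \<Longrightarrow> v \<notin> S \<Longrightarrow> eval (a(v := x)) f = eval a f"
  by (rule symbol_eval_cong) auto

lemma symbol_eval_add:
  assumes "symbol S d f q" "v \<in> S"
  shows "eval (a(v := x + y)) f = eval (a(v := x)) f + eval (a(v := y)) f"
  using assms
proof (induction rule: symbol.induct)
  case (mult S d f q T e g r)
  show ?case
  proof (cases "v \<in> S")
    case True
    then have "v \<notin> T" using mult.hyps(3) by auto
    show ?thesis
      by (simp only: eval_simps symbol_eval_upd[OF mult.hyps(2) \<open>v \<notin> T\<close>] mult.IH(1)[OF True] distrib_right)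
  next
    case False
    with mult.prems have "v \<in> T" by auto
    show ?thesis
      by (simp only: eval_simps symbol_eval_upd[OF mult.hyps(1) False] mult.IH(2)[OF \<open>v \<in> T\<close>] distrib_left)
  qed
next
  case (angle S d f q T e g r)
  show ?case
  proof (cases "v \<in> S")
    case True
    then have "v \<notin> T" using angle.hyps(3) by auto
    show ?thesis
      by (simp only: eval_angle symbol_eval_upd[OF angle.hyps(2) \<open>v \<notin> T\<close>] angle.IH(1)[OF True] angle_add_left)
  next
    case False
    with angle.prems have "v \<in> T" by auto
    show ?thesis
      by (simp only: eval_angle symbol_eval_upd[OF angle.hyps(1) False] angle.IH(2)[OF \<open>v \<in> T\<close>] angle_add_right)
  qed
qed (simp_all add: D_add algebra_simps scale_right_distrib fun_upd_same del: fun_upd_apply)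

text \<open>The hypothesis makes \<open>c\<close> a constant for the bracket. The intended instance
  is \<open>fps_X\<close>, by \<open>series_bracket_X\<close>.\<close>

lemma symbol_eval_mult:
  assumes c: "\<And>a b. bracket (c * a) b = c * bracket a b"
    and "symbol S d f q" "v \<in> S"
  shows "eval (a(v := c * x)) f = c * eval (a(v := x)) f"
  using assms(2,3)
proof (induction rule: symbol.induct)
  case (scale S d f q k)
  then show ?case by (simp add: mult_scale_right)
next
  case (mult S d f q T e g r)
  show ?case
  proof (cases "v \<in> S")
    case True
    then have "v \<notin> T" using mult.hyps(3) by auto
    show ?thesis
      by (simp only: eval_simps symbol_eval_upd[OF mult.hyps(2) \<open>v \<notin> T\<close>] mult.IH(1)[OF True] mult.assoc)
  next
    case False
    with mult.prems have "v \<in> T" by auto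
    show ?thesis
      by (simp only: eval_simps symbol_eval_upd[OF mult.hyps(1) False] mult.IH(2)[OF \<open>v \<in> T\<close>] mult.left_commute)
  qed
next
  case (D S d f q)
  then show ?case by (simp add: D_def c)
next
  case (angle S d f q T e g r)
  have left: "angle (c * y) z = c * angle y z" for y z
    by (simp add: angle_def D_def c algebra_simps)
  have right: "angle y (c * z) = c * angle y z" for y z
    using left[of z y] by (simp add: angle_anticomm[of y])
  show ?case
  proof (cases "v \<in> S")
    case True
    then have "v \<notin> T" using angle.hyps(3) by auto
    show ?thesis
      by (simp only: eval_angle symbol_eval_upd[OF angle.hyps(2) \<open>v \<notin> T\<close>] angle.IH(1)[OF True] left)
  next
    case False
    with angle.prems have "v \<in> T" by auto
    show ?thesis
      by (simp only: eval_angle symbol_eval_upd[OF angle.hyps(1) False] angle.IH(2)[OF \<open>v \<in> T\<close>] right)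
  qed
qed (simp_all add: algebra_simps fun_upd_same del: fun_upd_apply)

end

section \<open>Power series over a generalized Poisson algebra\<close>

unbundle fps_syntax

definition fps_scale :: "('k \<Rightarrow> 'a \<Rightarrow> 'a) \<Rightarrow> 'k \<Rightarrow> 'a fps \<Rightarrow> 'a fps" where
  "fps_scale s c p = Abs_fps (\<lambda>n. s c (p $ n))"

definition fps_bracket :: "('a \<Rightarrow> 'a \<Rightarrow> 'a::comm_monoid_add) \<Rightarrow> 'a fps \<Rightarrow> 'a fps \<Rightarrow> 'a fps" where
  "fps_bracket b p q = Abs_fps (\<lambda>n. \<Sum>i=0..n. b (p $ i) (q $ (n - i)))"

text \<open>Both sums run over all triples of indices with sum \<open>n\<close>. The exchange is
  needed where the first series of a law acts past the second one, as in
  \<open>q * fps_bracket b p r\<close>.\<close>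

lemma triangle_swap:
  fixes f :: "nat \<Rightarrow> nat \<Rightarrow> nat \<Rightarrow> 'a::comm_monoid_add"
  shows "(\<Sum>j=0..n. \<Sum>i=0..n - j. f j i (n - j - i)) = (\<Sum>j=0..n. \<Sum>i=0..n - j. f i j (n - j - i))"
proof -
  have "(\<Sum>j=0..n. \<Sum>i=0..n - j. f j i (n - j - i)) = (\<Sum>j=0..n. \<Sum>i=0..j. f i (j - i) (n - j))"
    by (rule fps_mult_assoc_lemma[symmetric])
  also have "\<dots> = (\<Sum>j=0..n. \<Sum>i=0..j. f (j - i) i (n - j))"
    by (rule sum.cong[OF HOL.refl], subst sum.atLeastAtMost_rev, rule sum.cong) simp_all
  also have "\<dots> = (\<Sum>j=0..n. \<Sum>i=0..n - j. f i j (n - j - i))"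
    by (rule fps_mult_assoc_lemma)
  finally show ?thesis .
qed

text \<open>The series variable is treated as a constant of the bracket. All axioms are multilinear,
  so they hold coefficientwise; the Leibniz rule and the Jacobi identity become sums over triples of
  indices.\<close>

lemma char0_gpa_fps:
  fixes scale :: "'k::field_char_0 \<Rightarrow> 'a::comm_ring_1 \<Rightarrow> 'a"
  assumes "char0_gpa scale bracket"
  shows "char0_gpa (fps_scale scale) (fps_bracket bracket)"
proof -
  interpret char0_gpa scale bracket by fact
  have one: "fps_bracket bracket p 1 $ n = D (p $ n)" for p n
  proof -
    have "fps_bracket bracket p 1 $ n = (\<Sum>i=0..n. if i = n then bracket (p $ i) 1 else 0)"
      unfolding fps_bracket_def fps_nth_Abs_fps by (rule sum.cong) auto
    also have "\<dots> = bracket (p $ n) 1"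
      by (subst sum.delta) auto
    finally show ?thesis by (simp add: D_def)
  qed
  show ?thesis
  proof
    fix c c' :: 'k and p q r :: "'a fps"
    show "fps_scale scale c (p + q) = fps_scale scale c p + fps_scale scale c q"
      by (simp add: fps_eq_iff fps_scale_def scale_right_distrib)
    show "fps_scale scale (c + c') p = fps_scale scale c p + fps_scale scale c' p"
      by (simp add: fps_eq_iff fps_scale_def scale_left_distrib)
    show "fps_scale scale c (fps_scale scale c' p) = fps_scale scale (c * c') p"
      by (simp add: fps_eq_iff fps_scale_def)
    show "fps_scale scale 1 p = p"
      by (simp add: fps_eq_iff fps_scale_def)
    show "fps_scale scale c (p * q) = fps_scale scale c p * q"
      by (simp add: fps_eq_iff fps_scale_def fps_mult_nth scale_sum_right scale_mult)
    show "fps_bracket bracket (p + q) r = fps_bracket bracket p r + fps_bracket bracket q r"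
      by (simp add: fps_eq_iff fps_bracket_def bracket_add sum.distrib)
    show "fps_bracket bracket (fps_scale scale c p) q = fps_scale scale c (fps_bracket bracket p q)"
      by (simp add: fps_eq_iff fps_bracket_def fps_scale_def bracket_scale scale_sum_right)
    show "fps_bracket bracket p q = - fps_bracket bracket q p"
    proof (rule fps_ext)
      fix n
      have "(\<Sum>i=0..n. bracket (p $ i) (q $ (n - i))) = (\<Sum>i=0..n. bracket (p $ (n - i)) (q $ i))"
        by (subst sum.atLeastAtMost_rev) simp
      also have "\<dots> = (\<Sum>i=0..n. - bracket (q $ i) (p $ (n - i)))"
        by (intro sum.cong HOL.refl bracket_anticomm)
      finally show "fps_bracket bracket p q $ n = (- fps_bracket bracket q p) $ n"
        by (simp add: fps_bracket_def sum_negf)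
    qed
    show "fps_bracket bracket p (q * r) = fps_bracket bracket p q * r + q * fps_bracket bracket p r
      - fps_bracket bracket p 1 * q * r" (is "?L = ?A + ?B - ?C")
    proof (rule fps_ext)
      fix n
      have A: "?A $ n = (\<Sum>j=0..n. \<Sum>i=0..n - j. bracket (p $ j) (q $ i) * r $ (n - j - i))"
        using fps_mult_assoc_lemma[of "\<lambda>j i m. bracket (p $ j) (q $ i) * r $ m" n n]
        by (simp add: fps_mult_nth fps_bracket_def sum_distrib_right)
      have B: "?B $ n = (\<Sum>j=0..n. \<Sum>i=0..n - j. q $ i * bracket (p $ j) (r $ (n - j - i)))"
        using triangle_swap[of "\<lambda>j i m. q $ j * bracket (p $ i) (r $ m)" n]
        by (simp add: fps_mult_nth fps_bracket_def sum_distrib_left)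
      have C: "?C $ n = (\<Sum>j=0..n. \<Sum>i=0..n - j. bracket (p $ j) 1 * q $ i * r $ (n - j - i))"
        using fps_mult_assoc_lemma[of "\<lambda>j i m. bracket (p $ j) 1 * q $ i * r $ m" n n]
        by (simp add: fps_mult_nth one D_def sum_distrib_right)
      show "?L $ n = (?A + ?B - ?C) $ n"
        unfolding fps_add_nth fps_sub_nth A B C
        by (simp add: fps_bracket_def fps_mult_nth bracket_sum_right bracket_mult sum.distrib sum_subtractf)
    qed
    show "fps_bracket bracket p (fps_bracket bracket q r) =
      fps_bracket bracket (fps_bracket bracket p q) r + fps_bracket bracket q (fps_bracket bracket p r)"
      (is "?L = ?A + ?B")
    proof (rule fps_ext)
      fix n
      have A: "?A $ n = (\<Sum>j=0..n. \<Sum>i=0..n - j. bracket (bracket (p $ j) (q $ i)) (r $ (n - j - i)))"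
        using fps_mult_assoc_lemma[of "\<lambda>j i m. bracket (bracket (p $ j) (q $ i)) (r $ m)" n n]
        by (simp add: fps_bracket_def bracket_sum_left)
      have B: "?B $ n = (\<Sum>j=0..n. \<Sum>i=0..n - j. bracket (q $ i) (bracket (p $ j) (r $ (n - j - i))))"
        using triangle_swap[of "\<lambda>j i m. bracket (q $ j) (bracket (p $ i) (r $ m))" n]
        by (simp add: fps_bracket_def bracket_sum_right)
      have "?L $ n = (\<Sum>j=0..n. \<Sum>i=0..n - j. bracket (p $ j) (bracket (q $ i) (r $ (n - j - i))))"
        by (simp add: fps_bracket_def bracket_sum_right)
      then show "?L $ n = (?A + ?B) $ n"
        unfolding fps_add_nth A B by (subst (asm) bracket_jacobi) (simp add: sum.distrib)
    qed
  qed
qed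

lemma fps_shift_decomp: "p = fps_const (p $ 0) + fps_X * fps_shift 1 (p :: 'a::comm_ring_1 fps)"
  by (rule fps_ext) (simp add: fps_X_mult_nth)

global_interpretation series: char0_gpa
    "fps_scale (free_scale :: 'k::field_char_0 \<Rightarrow> ('k, 'v) free_gpa \<Rightarrow> _)" "fps_bracket free_bracket"
  by (rule char0_gpa_fps) (rule free.char0_gpa_axioms)

lemma series_bracket_const:
  "fps_bracket free_bracket (fps_const f) p $ n = free_bracket f (p $ n)" 
  for f :: "('k::field_char_0, 'v) free_gpa"
proof -
  have "fps_bracket free_bracket (fps_const f) p $ n
      = (\<Sum>i=0..n. if i = 0 then free_bracket f (p $ n) else 0)"
    unfolding fps_bracket_def fps_nth_Abs_fps by (rule sum.cong) auto
  also have "\<dots> = free_bracket f (p $ n)" by (subst sum.delta) auto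
  finally show ?thesis .
qed

lemma series_bracket_X:
  "fps_bracket free_bracket (fps_X * p) q = fps_X * fps_bracket free_bracket p q"
  for p :: "('k::field_char_0, 'v) free_gpa fps"
proof (rule fps_ext)
  fix n show "fps_bracket free_bracket (fps_X * p) q $ n = (fps_X * fps_bracket free_bracket p q) $ n"
  proof (cases n)
    case 0 then show ?thesis by (simp add: fps_bracket_def)
  next
    case (Suc m)
    then show ?thesis
      by (simp add: fps_bracket_def fps_X_mult_nth sum.atLeast0_atMost_Suc_shift del: sum.cl_ivl_Suc)
  qed
qed

lemma series_D_nth: "series.D p $ n = free.D (p $ n)" for p :: "('k::field_char_0, 'v) free_gpa fps"
proof -
  have "fps_bracket free_bracket p 1 $ n = (\<Sum>i=0..n. if i = n then free_bracket (p $ n) 1 else 0)"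
    unfolding fps_bracket_def fps_nth_Abs_fps by (rule sum.cong) auto
  also have "\<dots> = free_bracket (p $ n) 1" by (subst sum.delta) auto
  finally show ?thesis by (simp add: series.D_def free.D_def)
qed

lemma series_angle_nth: "series.angle p q $ n = (\<Sum>i=0..n. free.angle (p $ i) (q $ (n - i)))"
  for p :: "('k::field_char_0, 'v) free_gpa fps"
  by (simp add: series.angle_def free.angle_def fps_bracket_def fps_mult_nth series_D_nth
      sum_subtractf sum.distrib)

lemma series_D_const: "series.D (fps_const f) = fps_const (free.D f)"
  for f :: "('k::field_char_0, 'v) free_gpa"
  by (rule fps_ext) (simp add: series_D_nth free.D_zero)

lemma series_angle_const: "series.angle (fps_const f) p $ n = free.angle f (p $ n)"
  for f :: "('k::field_char_0, 'v) free_gpa"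
  unfolding series.angle_def free.angle_def fps_sub_nth series_bracket_const series_D_const
  by (simp add: series_D_nth)

lemma series_eval_const:
  "series.eval (\<lambda>v. fps_const (c v)) f = fps_const (free.eval c f)"
  for c :: "'w \<Rightarrow> ('k::field_char_0, 'v) free_gpa"
proof (induction f rule: free_gpa_induct)
  case (bracket f g)
  show ?case
    unfolding series.eval_simps free.eval_simps bracket
    by (rule fps_ext) (simp add: series_bracket_const)
next
  case (scale k f)
  show ?case
    unfolding series.eval_simps free.eval_simps scale
    by (rule fps_ext) (simp add: fps_scale_def)
qed simp_all

section \<open>Values of an identity at power series\<close>

context char0_gpa
begin

text \<open>A multilinear \<open>f\<close> expands over the coefficients of its arguments, and its
  values at constant series are substitution instances of \<open>f\<close>. The proof admits
  nonconstant arguments one variable at a time.\<close>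

lemma identity_series:
  fixes f :: "('k, 'v) free_gpa" and h :: "'v \<Rightarrow> ('k, 'w) free_gpa fps"
  assumes f: "polynomial_identity f" "symbol S d f q"
  shows "polynomial_identity (series.eval h f $ n)"
proof -
  have *: "finite V \<Longrightarrow> (\<And>v. v \<notin> V \<Longrightarrow> \<exists>c. h v = fps_const c) \<Longrightarrow> polynomial_identity (series.eval h f $ n)"
    for V n and h :: "'v \<Rightarrow> ('k, 'w) free_gpa fps"
  proof (induction V arbitrary: h n rule: finite_induct)
    case empty
    then obtain c where "h = (\<lambda>v. fps_const (c v))" by (metis empty_iff)
    then show ?case
      by (cases n) (simp_all add: series_eval_const identity_eval f identity_zero)
  next
    case (insert v V)
    have const: "polynomial_identity (series.eval (h(v := fps_const c)) f $ m)" for c m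
      by (rule insert.IH) (use insert.prems in \<open>metis fun_upd_apply insert_iff\<close>)
    show ?case
    proof (cases "v \<in> S")
      case False
      then show ?thesis using const[of 0 n] series.symbol_eval_upd[OF f(2) False, of h "fps_const 0"] by simp
    next
      case True
      \<comment> \<open>Induction on the index of the coefficient: in \<open>p = p_0 + X p'\<close>
        the factor \<open>fps_X\<close> moves out of \<open>f\<close>, so the index for
        \<open>p'\<close> is one smaller.\<close>
      have "polynomial_identity (series.eval (h(v := p)) f $ m)" for p m
      proof (induction m arbitrary: p)
        case (0 p)
        have "series.eval (h(v := p)) f = series.eval (h(v := fps_const (p $ 0))) f
          + fps_X * series.eval (h(v := fps_shift 1 p)) f"
          by (subst fps_shift_decomp) (simp only: series.symbol_eval_add[OF f(2) True]
             series.symbol_eval_mult[OF series_bracket_X f(2) True])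
        then show ?case by (simp add: const del: fun_upd_apply)
      next
        case (Suc m p)
        have "series.eval (h(v := p)) f = series.eval (h(v := fps_const (p $ 0))) f
          + fps_X * series.eval (h(v := fps_shift 1 p)) f"
          by (subst fps_shift_decomp) (simp only: series.symbol_eval_add[OF f(2) True]
             series.symbol_eval_mult[OF series_bracket_X f(2) True])
        then show ?case by (simp add: const Suc identity_add del: fun_upd_apply)
      qed
      from this[of "h v"] show ?thesis by simp
    qed
  qed
  have "polynomial_identity (series.eval (\<lambda>v. if v \<in> S then h v else fps_const 0) f $ n)"
    by (rule *[OF symbol_finite[OF f(2)]]) auto
  also have "series.eval (\<lambda>v. if v \<in> S then h v else fps_const 0) f = series.eval h f"
    by (rule series.symbol_eval_cong[OF f(2)]) simp
  finally show ?thesis .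
qed

end

context char0_gpa
begin

lemma D_power: "D (y ^ Suc n) = scale (of_nat (Suc n)) (y ^ n * D y)"
proof (induction n)
  case (Suc n)
  have "D (y ^ Suc (Suc n)) = D y * y ^ Suc n + y * D (y ^ Suc n)"
    by (simp only: power_Suc[of y "Suc n"] D_mult)
  also have "y * D (y ^ Suc n) = scale (of_nat (Suc n)) (y ^ Suc n * D y)"
    unfolding Suc mult_scale_right by (simp add: mult.assoc)
  finally show ?case
    by (simp only: of_nat_Suc[of "Suc n"] scale_left_distrib scale_one ac_simps)
qed simp

lemma angle_power: "angle (y ^ Suc n) a = scale (of_nat (Suc n)) (y ^ n * angle y a)"
proof (induction n)
  case (Suc n)
  have "angle (y ^ Suc (Suc n)) a = angle y a * y ^ Suc n + y * angle (y ^ Suc n) a"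
    by (simp only: power_Suc[of y "Suc n"] angle_mult_left)
  also have "y * angle (y ^ Suc n) a = scale (of_nat (Suc n)) (y ^ Suc n * angle y a)"
    unfolding Suc mult_scale_right by (simp add: mult.assoc)
  finally show ?case
    by (simp only: of_nat_Suc[of "Suc n"] scale_left_distrib scale_one ac_simps)
qed simp

end

lemma free_of_nat: "of_nat n * f = free_scale (of_nat n) f" for f :: "('k::field_char_0, 'v) free_gpa"
  by (induction n) (simp_all add: free.scale_left_distrib distrib_right)

section \<open>Evaluation at exponentials\<close>

definition series_exp :: "('k::field_char_0, 'v) free_gpa \<Rightarrow> ('k, 'v) free_gpa fps" where
  "series_exp y = Abs_fps (\<lambda>n. free_scale (1 / fact n) (y ^ n))"

lemma series_exp_zero: "series_exp 0 = 1"
  by (rule fps_ext) (simp add: series_exp_def power_0_left)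

lemma series_exp_add: "series_exp (y + z) = series_exp y * series_exp z"
proof (rule fps_ext)
  fix n
  have "series_exp (y + z) $ n = free_scale (1 / fact n)
      (\<Sum>k=0..n. of_nat (n choose k) * y ^ k * z ^ (n - k))"
    by (simp add: series_exp_def binomial_ring atLeast0AtMost)
  also have "\<dots> = (\<Sum>k=0..n. free_scale (1 / fact n * of_nat (n choose k)) (y ^ k * z ^ (n - k)))"
    by (simp only: free.scale_sum_right free_of_nat free.scale_scale flip: free.scale_mult)
  also have "\<dots> = (\<Sum>k=0..n. free_scale (1 / fact k * (1 / fact (n - k))) (y ^ k * z ^ (n - k)))"
    by (rule sum.cong) (simp_all add: binomial_fact field_simps)
  also have "\<dots> = (series_exp y * series_exp z) $ n"
    by (simp add: series_exp_def fps_mult_nth free.scale_mult[symmetric] free.mult_scale_right mult.commute)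
  finally show "series_exp (y + z) $ n = (series_exp y * series_exp z) $ n" .
qed

lemma scale_fact_Suc:
  "free_scale (1 / fact (Suc m)) (free_scale (of_nat (Suc m)) x) = free_scale (1 / fact m) x"
  for x :: "('k::field_char_0, 'v) free_gpa"
  by (simp add: field_simps del: of_nat_Suc)

lemma series_D_exp:
  fixes y :: "('k::field_char_0, 'v) free_gpa"
  shows "series.D (series_exp y) = series_exp y * (fps_X * fps_const (free.D y))"
proof (rule fps_ext)
  fix n
  show "series.D (series_exp y) $ n = (series_exp y * (fps_X * fps_const (free.D y))) $ n"
  proof (cases n)
    case 0
    then show ?thesis by (simp add: series_D_nth series_exp_def free.D_one)
  next
    case (Suc m)
    have "series.D (series_exp y) $ n = free_scale (1 / fact m) (y ^ m * free.D y)"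
      unfolding Suc series_D_nth series_exp_def fps_nth_Abs_fps free.D_scale free.D_power scale_fact_Suc
      by (rule HOL.refl)
    also have "\<dots> = (series_exp y * fps_const (free.D y)) $ m"
      by (simp add: series_exp_def free.scale_mult)
    also have "\<dots> = (series_exp y * (fps_X * fps_const (free.D y))) $ n"
      by (simp only: Suc mult.left_commute[of _ fps_X] fps_X_mult_nth) simp
    finally show ?thesis .
  qed
qed

text \<open>A derivation acts on exp(t y) as multiplication by t times its value at y, and
  \<open>angle\<close> is a derivation in its first argument for any second argument
  \<open>p\<close>.\<close>

lemma series_angle_exp:
  fixes y :: "('k::field_char_0, 'v) free_gpa"
  shows "series.angle (series_exp y) p = series_exp y * (fps_X * series.angle (fps_const y) p)"
proof (rule fps_ext)
  fix n
  show "series.angle (series_exp y) p $ n = (series_exp y * (fps_X * series.angle (fps_const y) p)) $ n"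
  proof (cases n)
    case 0
    then show ?thesis by (simp add: series_angle_nth series_exp_def)
  next
    case (Suc m)
    have "series.angle (series_exp y) p $ n
        = (\<Sum>i=0..m. free.angle (series_exp y $ Suc i) (p $ (m - i)))"
      unfolding series_angle_nth Suc sum.atLeast0_atMost_Suc_shift by (simp add: series_exp_def)
    also have "\<dots> = (\<Sum>i=0..m. series_exp y $ i * free.angle y (p $ (m - i)))"
      unfolding series_exp_def fps_nth_Abs_fps free.angle_scale_left free.angle_power scale_fact_Suc free.scale_mult
      by (rule HOL.refl)
    also have "\<dots> = (series_exp y * series.angle (fps_const y) p) $ m"
      by (simp add: fps_mult_nth series_angle_const)
    also have "\<dots> = (series_exp y * (fps_X * series.angle (fps_const y) p)) $ n"
      by (simp add: Suc mult.left_commute[of _ fps_X])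
    finally show ?thesis .
  qed
qed

text \<open>A polynomial of degree at most \<open>d\<close>; the value \<open>q = 0\<close> is
  allowed, in accordance with the rule \<open>weaken\<close> of \<open>symbol\<close>.\<close>

definition top_coeff :: "nat \<Rightarrow> 'a::zero fps \<Rightarrow> 'a \<Rightarrow> bool" where
  "top_coeff d p q \<longleftrightarrow> p $ d = q \<and> (\<forall>n>d. p $ n = 0)"

lemma top_coeff_convolution:
  assumes "top_coeff d p q" "top_coeff e r s"
    and "\<And>x. b 0 x = 0" "\<And>x. b x 0 = 0"
    and "\<And>n. z $ n = (\<Sum>i=0..n. b (p $ i) (r $ (n - i)))"
  shows "top_coeff (d + e) z (b q s :: 'a::comm_monoid_add)"
proof -
  have "z $ n = 0" if "n > d + e" for n
  proof -
    have "b (p $ i) (r $ (n - i)) = 0" for i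
      using assms(1-4) that unfolding top_coeff_def by (cases "i > d") auto
    then show ?thesis by (simp add: assms(5))
  qed
  moreover have "z $ (d + e) = b q s"
  proof -
    have "z $ (d + e) = (\<Sum>i=0..d + e. if i = d then b q s else 0)"
      unfolding assms(5)
    proof (rule sum.cong)
      fix i
      consider "i < d" | "i = d" | "i > d" by linarith
      then show "b (p $ i) (r $ (d + e - i)) = (if i = d then b q s else 0)"
        by cases (use assms(1-4) in \<open>auto simp: top_coeff_def\<close>)
    qed simp
    then show ?thesis by (simp add: sum.delta)
  qed
  ultimately show ?thesis by (simp add: top_coeff_def)
qed

lemma top_coeff_mult:
  "top_coeff d p q \<Longrightarrow> top_coeff e r s \<Longrightarrow> top_coeff (d + e) (p * r) (q * s :: 'a::comm_ring_1)"
  by (rule top_coeff_convolution[where b = "(*)"]) (auto simp: fps_mult_nth)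

lemma top_coeff_angle:
  "top_coeff d p q \<Longrightarrow> top_coeff e r s \<Longrightarrow> top_coeff (d + e) (series.angle p r) (free.angle q s)"
  by (rule top_coeff_convolution[where b = free.angle]) (auto simp: series_angle_nth)

lemma top_coeff_angle_const:
  "top_coeff d p q \<Longrightarrow> top_coeff d (series.angle (fps_const y) p) (free.angle y q)"
  by (simp add: top_coeff_def series_angle_const)

lemma top_coeff_D: "top_coeff d p q \<Longrightarrow> top_coeff d (series.D p) (free.D q)"
  by (simp add: top_coeff_def series_D_nth free.D_zero)

lemma top_coeff_X: "top_coeff d p q \<Longrightarrow> top_coeff (Suc d) (fps_X * p) (q :: 'a::comm_ring_1)"
  by (auto simp: top_coeff_def fps_X_mult_nth)

lemma top_coeff_Suc: "top_coeff d p q \<Longrightarrow> top_coeff (Suc d) p 0"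
  by (auto simp: top_coeff_def)

lemma top_coeff_add: "top_coeff d p q \<Longrightarrow> top_coeff d r s \<Longrightarrow> top_coeff d (p + r) (q + s :: 'a::comm_ring_1)"
  by (auto simp: top_coeff_def)

lemma top_coeff_diff: "top_coeff d p q \<Longrightarrow> top_coeff d r s \<Longrightarrow> top_coeff d (p - r) (q - s :: 'a::comm_ring_1)"
  by (auto simp: top_coeff_def)

lemma top_coeff_const: "top_coeff 0 (fps_const c) c"
  by (auto simp: top_coeff_def)

text \<open>This explains the rules of \<open>symbol\<close>: \<open>series_exp (vsum S)\<close> is
  the product of the exponentials of the arguments, and the top degree is reached only where the
  outer operation differentiates exponentials and leaves the polynomial factors alone.\<close>

lemma symbol_exp:
  fixes f :: "('k::field_char_0, 'v) free_gpa"
  assumes "symbol S d f q"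
  shows "\<exists>p. series.eval (\<lambda>v. series_exp (gen v)) f = series_exp (vsum S) * p \<and> top_coeff d p q"
  using assms
proof (induction rule: symbol.induct)
  case (zero S d)
  show ?case by (rule exI[of _ 0]) (simp add: top_coeff_def)
next
  case one
  show ?case by (rule exI[of _ 1]) (simp add: top_coeff_def series_exp_zero)
next
  case (gen v)
  show ?case by (rule exI[of _ 1]) (simp add: top_coeff_def)
next
  case (add S d f q g r)
  then obtain p1 p2 where "series.eval (\<lambda>v. series_exp (gen v)) f = series_exp (vsum S) * p1"
    "top_coeff d p1 q" "series.eval (\<lambda>v. series_exp (gen v)) g = series_exp (vsum S) * p2"
    "top_coeff d p2 r" by blast
  then show ?case by (intro exI[of _ "p1 + p2"]) (simp add: top_coeff_add distrib_left)
next
  case (scale S d f q c)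
  then obtain p where "series.eval (\<lambda>v. series_exp (gen v)) f = series_exp (vsum S) * p"
    "top_coeff d p q" by blast
  then show ?case
    by (intro exI[of _ "fps_scale free_scale c p"])
      (auto simp: top_coeff_def series.mult_scale_right, auto simp: fps_scale_def)
next
  case (mult S d f q T e g r)
  then obtain p1 p2 where "series.eval (\<lambda>v. series_exp (gen v)) f = series_exp (vsum S) * p1"
    "top_coeff d p1 q" "series.eval (\<lambda>v. series_exp (gen v)) g = series_exp (vsum T) * p2"
    "top_coeff e p2 r" by blast
  then show ?case
    by (intro exI[of _ "p1 * p2"])
      (simp add: top_coeff_mult vsum_Un symbol_finite[OF mult.hyps(1)] symbol_finite[OF mult.hyps(2)]
        mult.hyps(3) series_exp_add ac_simps)
next
  case (D S d f q)
  then obtain p where p: "series.eval (\<lambda>v. series_exp (gen v)) f = series_exp (vsum S) * p"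
    "top_coeff d p q" by blast
  have "top_coeff (Suc d) (series.D p + fps_X * (fps_const (free.D (vsum S)) * p))
     (0 + free.D (vsum S) * q)"
    using top_coeff_mult[OF top_coeff_const p(2)]
    by (intro top_coeff_add top_coeff_X top_coeff_Suc[OF top_coeff_D[OF p(2)]]) simp
  then show ?case
    by (intro exI[of _ "series.D p + fps_X * (fps_const (free.D (vsum S)) * p)"])
      (simp add: p series.D_mult series_D_exp algebra_simps)
next
  case (angle S d f q T e g r)
  then obtain p1 p2 where p: "series.eval (\<lambda>v. series_exp (gen v)) f = series_exp (vsum S) * p1"
    "top_coeff d p1 q" "series.eval (\<lambda>v. series_exp (gen v)) g = series_exp (vsum T) * p2"
    "top_coeff e p2 r" by blast
  define y z where "y = (vsum S :: ('k, 'v) free_gpa)" and "z = (vsum T :: ('k, 'v) free_gpa)"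
  define A B C where "A = series.angle (fps_const y) p2" and "B = series.angle (fps_const z) p1"
    and "C = fps_const (free.angle y z) * (p1 * p2)"
  \<comment> \<open>The quotient of the angle bracket of \<open>series_exp y * p1\<close> and
    \<open>series_exp z * p2\<close> by both exponentials, sorted by how many exponentials are
    differentiated. Each of these costs one \<open>fps_X\<close>, so only the term with
    \<open>C\<close> reaches the top degree.\<close>
  define P where "P = series.angle p1 p2 + fps_X * (A * p1 - B * p2) + fps_X * (fps_X * C)"
  have yz: "series.angle (fps_const y) (series_exp z) = series_exp z * (fps_X * fps_const (free.angle y z))"
  proof -
    have "series.angle (fps_const z) (fps_const y) = - fps_const (free.angle y z)"
      by (rule fps_ext) (simp add: series_angle_const free.angle_anticomm[of z y])
    then show ?thesis
      by (simp only: series.angle_anticomm[of "fps_const y"] series_angle_exp mult_minus_right minus_minus)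
  qed
  have "series.angle (series_exp y * p1) (series_exp z * p2) = series_exp y * series_exp z * P"
    unfolding P_def A_def B_def C_def
    by (simp add: series.angle_mult_left series.angle_mult_right series_angle_exp
       series.angle_anticomm[of p1 "series_exp z"] yz algebra_simps)
  moreover have "top_coeff (Suc (Suc (d + e))) P (0 + 0 + free.angle y z * (q * r))"
    unfolding P_def
  proof (intro top_coeff_add top_coeff_X)
    show "top_coeff (Suc (Suc (d + e))) (series.angle p1 p2) 0"
      by (rule top_coeff_Suc top_coeff_angle[OF p(2,4)])+
    have "top_coeff (d + e) (A * p1) (free.angle y r * q)" "top_coeff (d + e) (B * p2) (free.angle z q * r)"
      using top_coeff_mult[OF top_coeff_angle_const[OF p(4), of y] p(2)]
        top_coeff_mult[OF top_coeff_angle_const[OF p(2), of z] p(4)]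
      unfolding A_def B_def by (simp_all add: add.commute)
    from top_coeff_Suc[OF top_coeff_diff[OF this]]
    show "top_coeff (Suc (d + e)) (A * p1 - B * p2) 0" .
    show "top_coeff (d + e) C (free.angle y z * (q * r))"
      unfolding C_def using top_coeff_mult[OF top_coeff_const top_coeff_mult[OF p(2,4)]] by simp
  qed
  ultimately show ?case
    by (intro exI[of _ P])
      (simp add: p vsum_Un symbol_finite[OF angle.hyps(1)] symbol_finite[OF angle.hyps(2)]
        angle.hyps(3) series_exp_add flip: y_def z_def)
next
  case (weaken S d f q)
  then obtain p where "series.eval (\<lambda>v. series_exp (gen v)) f = series_exp (vsum S) * p"
    "top_coeff d p q" by blast
  then show ?case by (intro exI[of _ p] conjI top_coeff_Suc)
qed

context char0_gpa
begin

text \<open>Multiplication by \<open>series_exp (- vsum S)\<close> undoes the factor in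
  \<open>symbol_exp\<close>. The symbol becomes a combination, with multipliers from the free
  algebra, of coefficients that are identities, and identities form an ideal.\<close>

lemma identity_symbol:
  assumes "polynomial_identity f" "symbol S d f q"
  shows "polynomial_identity q"
proof -
  let ?F = "series.eval (\<lambda>v. series_exp (gen v)) f"
  obtain p where p: "?F = series_exp (vsum S) * p" "top_coeff d p q"
    using symbol_exp[OF assms(2)] by blast
  have "p = series_exp (- vsum S) * ?F"
    unfolding p(1) by (simp add: mult.assoc[symmetric] series_exp_zero flip: series_exp_add)
  then have "q = (\<Sum>i=0..d. series_exp (- vsum S) $ i * ?F $ (d - i))"
    using p(2) by (simp add: top_coeff_def fps_mult_nth)
  then show ?thesis
    by (simp add: identity_sum identity_mult identity_series[OF assms])
qed

end

section \<open>A model with prescribed values of D and the angle bracket\<close>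

text \<open>Reduces the laws of additive operations on the monoid algebra to basis elements.\<close>

lemma poly_mapping_add_induct [case_names zero single add]:
  assumes "P 0" "\<And>a x. P (Poly_Mapping.single a x)" "\<And>p q. P p \<Longrightarrow> P q \<Longrightarrow> P (p + q)"
  shows "P (p :: 'g \<Rightarrow>\<^sub>0 'b::comm_monoid_add)"
proof -
  have "p = (\<Sum>a\<in>Poly_Mapping.keys p. Poly_Mapping.single a (Poly_Mapping.lookup p a))"
    by (rule poly_mapping_eqI) (simp add: lookup_sum lookup_single when_def not_in_keys_iff_lookup_eq_zero)
  moreover have "P (\<Sum>a\<in>A. Poly_Mapping.single a (Poly_Mapping.lookup p a))" if "finite A" for A
    using that by (induction A) (simp_all add: assms)
  ultimately show ?thesis by (metis finite_keys)
qed

definition monoid_bracket ::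
    "('g \<Rightarrow> 'g \<Rightarrow> 'b) \<Rightarrow> 'g \<Rightarrow> ('g::comm_monoid_add \<Rightarrow>\<^sub>0 'b::comm_ring_1) \<Rightarrow> ('g \<Rightarrow>\<^sub>0 'b) \<Rightarrow> ('g \<Rightarrow>\<^sub>0 'b)" where
  "monoid_bracket B z p q = (\<Sum>a\<in>Poly_Mapping.keys p. \<Sum>b\<in>Poly_Mapping.keys q.
     Poly_Mapping.single (a + b + z) (Poly_Mapping.lookup p a * Poly_Mapping.lookup q b * B a b))"

lemma monoid_bracket_superset:
  assumes "finite A" "finite C" "Poly_Mapping.keys p \<subseteq> A" "Poly_Mapping.keys q \<subseteq> C"
  shows "monoid_bracket B z p q = (\<Sum>a\<in>A. \<Sum>b\<in>C.
     Poly_Mapping.single (a + b + z) (Poly_Mapping.lookup p a * Poly_Mapping.lookup q b * B a b))"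
proof -
  have "(\<Sum>b\<in>C. Poly_Mapping.single (a + b + z) (Poly_Mapping.lookup p a * Poly_Mapping.lookup q b * B a b))
    = (\<Sum>b\<in>Poly_Mapping.keys q. Poly_Mapping.single (a + b + z) (Poly_Mapping.lookup p a * Poly_Mapping.lookup q b * B a b))" for a
    using assms by (intro sum.mono_neutral_right) (auto simp: not_in_keys_iff_lookup_eq_zero)
  then show ?thesis
    unfolding monoid_bracket_def
    by (intro sum.mono_neutral_cong_left) (use assms in \<open>auto simp: not_in_keys_iff_lookup_eq_zero\<close>)
qed

lemma monoid_bracket_single:
  "monoid_bracket B z (Poly_Mapping.single a x) (Poly_Mapping.single b y)
    = Poly_Mapping.single (a + b + z) (x * y * B a b)"
  by (subst monoid_bracket_superset[of "{a}" "{b}"]) auto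

lemma monoid_bracket_add:
  "monoid_bracket B z (p + p') q = monoid_bracket B z p q + monoid_bracket B z p' q"
  "monoid_bracket B z q (p + p') = monoid_bracket B z q p + monoid_bracket B z q p'"
proof -
  let ?A = "Poly_Mapping.keys p \<union> Poly_Mapping.keys p'"
  have A: "finite ?A" "Poly_Mapping.keys p \<subseteq> ?A" "Poly_Mapping.keys p' \<subseteq> ?A" "Poly_Mapping.keys (p + p') \<subseteq> ?A"
    using keys_add[of p p'] by auto
  show "monoid_bracket B z (p + p') q = monoid_bracket B z p q + monoid_bracket B z p' q"
    using A by (simp add: monoid_bracket_superset[of ?A "Poly_Mapping.keys q"] lookup_add
       distrib_right single_add sum.distrib)
  show "monoid_bracket B z q (p + p') = monoid_bracket B z q p + monoid_bracket B z q p'"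
    using A by (simp add: monoid_bracket_superset[of "Poly_Mapping.keys q" ?A] lookup_add
       distrib_right distrib_left single_add sum.distrib)
qed

lemma monoid_bracket_zero [simp]: "monoid_bracket B z 0 q = 0" "monoid_bracket B z q 0 = 0"
  by (simp_all add: monoid_bracket_def)

definition monoid_scale :: "'b \<Rightarrow> ('g::comm_monoid_add \<Rightarrow>\<^sub>0 'b::comm_ring_1) \<Rightarrow> ('g \<Rightarrow>\<^sub>0 'b)" where
  "monoid_scale c p = Poly_Mapping.single 0 c * p"

text \<open>The hypotheses are the axioms on basis elements: in each axiom all terms are multiples
  of the same basis element. The term \<open>B a 0\<close> arises because 1 is the basis element at
  0.\<close>

lemma char0_gpa_monoid:
  fixes B :: "'g::comm_monoid_add \<Rightarrow> 'g \<Rightarrow> 'k::field_char_0"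
  assumes anti: "\<And>a b. B a b = - B b a"
    and leibniz: "\<And>a b c. B a (b + c) = B a b + B a c - B a 0"
    and jacobi: "\<And>a b c. B b c * B a (b + c + z) = B a b * B (a + b + z) c + B a c * B b (a + c + z)"
  shows "char0_gpa monoid_scale (monoid_bracket B z)"
proof (unfold_locales, unfold monoid_scale_def)
  fix c c' :: 'k and p q r :: "'g \<Rightarrow>\<^sub>0 'k"
  show "Poly_Mapping.single 0 c * (p + q) = Poly_Mapping.single 0 c * p + Poly_Mapping.single 0 c * q"
    by (rule distrib_left)
  show "Poly_Mapping.single 0 (c + c') * p = Poly_Mapping.single 0 c * p + Poly_Mapping.single 0 c' * p"
    unfolding single_add by (rule distrib_right)
  show "Poly_Mapping.single 0 c * (Poly_Mapping.single 0 c' * p) = Poly_Mapping.single 0 (c * c') * p"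
    by (simp only: mult_single add_0 flip: mult.assoc)
  show "Poly_Mapping.single 0 1 * p = p" by (simp only: single_one mult_1)
  show "Poly_Mapping.single 0 c * (p * q) = Poly_Mapping.single 0 c * p * q"
    by (simp only: mult.assoc)
  show "monoid_bracket B z (p + q) r = monoid_bracket B z p r + monoid_bracket B z q r"
    by (rule monoid_bracket_add)
  show "monoid_bracket B z (Poly_Mapping.single 0 c * p) q = Poly_Mapping.single 0 c * monoid_bracket B z p q"
  proof (induction p rule: poly_mapping_add_induct)
    case (single a x)
    show ?case
      by (induction q rule: poly_mapping_add_induct)
        (simp_all add: mult_single monoid_bracket_single monoid_bracket_add distrib_left mult.assoc)
  qed (simp_all add: distrib_left monoid_bracket_add)
  show "monoid_bracket B z p q = - monoid_bracket B z q p"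
  proof (induction p rule: poly_mapping_add_induct)
    case (single a x)
    show ?case
    proof (induction q rule: poly_mapping_add_induct)
      case (single b y)
      show ?case
        unfolding monoid_bracket_single anti[of a b]
        by (simp add: single_uminus ac_simps)
    qed (simp_all add: monoid_bracket_add)
  qed (simp_all add: monoid_bracket_add)
  have regroup: "(x1 + x2 - x3) + (y1 + y2 - y3) = (x1 + y1) + (x2 + y2) - (x3 + y3)"
    for x1 x2 x3 y1 y2 y3 :: "'g \<Rightarrow>\<^sub>0 'k"
    by simp
  show "monoid_bracket B z p (q * r) = monoid_bracket B z p q * r + q * monoid_bracket B z p r
    - monoid_bracket B z p 1 * q * r"
  proof (induction p rule: poly_mapping_add_induct)
    case (single a x)
    show ?case
    proof (induction q rule: poly_mapping_add_induct)
      case (single b y)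
      show ?case
      proof (induction r rule: poly_mapping_add_induct)
        case (single d u)
        have one: "monoid_bracket B z (Poly_Mapping.single a x) 1 = Poly_Mapping.single (a + z) (x * B a 0)"
          unfolding single_one[symmetric] monoid_bracket_single by simp
        have arg: "a + z + b + d = a + (b + d) + z" "a + b + z + d = a + (b + d) + z"
          "b + (a + d + z) = a + (b + d) + z"
          by (simp_all only: ac_simps)
        have "x * (y * u) * B a (b + d) = x * y * B a b * u + y * (x * u * B a d) - x * B a 0 * y * u"
          unfolding leibniz by (simp add: algebra_simps)
        then show ?case
          by (simp only: monoid_bracket_single mult_single one arg flip: single_add single_diff)
      next
        case (add f g)
        show ?case
          by (simp only: monoid_bracket_add distrib_left distrib_right add regroup)
      qed simp
    next
      case (add f g)
      show ?case
        by (simp only: monoid_bracket_add distrib_left distrib_right add regroup)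
    qed simp
  next
    case (add f g)
    show ?case
      by (simp only: monoid_bracket_add distrib_left distrib_right add regroup)
  qed simp
  show "monoid_bracket B z p (monoid_bracket B z q r)
    = monoid_bracket B z (monoid_bracket B z p q) r + monoid_bracket B z q (monoid_bracket B z p r)"
  proof (induction p rule: poly_mapping_add_induct)
    case (single a x)
    show ?case
    proof (induction q rule: poly_mapping_add_induct)
      case (single b y)
      show ?case
      proof (induction r rule: poly_mapping_add_induct)
        case (single d u)
        have arg: "a + (b + d + z) + z = a + b + d + z + z" "a + b + z + d + z = a + b + d + z + z"
          "b + (a + d + z) + z = a + b + d + z + z"
          by (simp_all only: ac_simps)
        have "x * (y * u * B b d) * B a (b + d + z) = x * y * u * (B b d * B a (b + d + z))"
          by (simp only: ac_simps)
        also have "\<dots> = x * y * B a b * u * B (a + b + z) d + y * (x * u * B a d) * B b (a + d + z)"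
          unfolding jacobi[of b d a] by (simp only: distrib_left ac_simps)
        finally show ?case
          by (simp only: monoid_bracket_single arg flip: single_add)
      qed (simp_all add: monoid_bracket_add ac_simps)
    qed (simp_all add: monoid_bracket_add ac_simps)
  qed (simp_all add: monoid_bracket_add ac_simps)
qed

text \<open>The ring homomorphism that sends every basis element to 1. Compatibility with products
  suffices, since a symbol is a polynomial in values of \<open>D\<close> and
  \<open>angle\<close>.\<close>

definition augment :: "('g \<Rightarrow>\<^sub>0 'b::comm_ring_1) \<Rightarrow> 'b" where
  "augment p = (\<Sum>a\<in>Poly_Mapping.keys p. Poly_Mapping.lookup p a)"

lemma augment_superset:
  "finite A \<Longrightarrow> Poly_Mapping.keys p \<subseteq> A \<Longrightarrow> augment p = (\<Sum>a\<in>A. Poly_Mapping.lookup p a)"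
  unfolding augment_def by (rule sum.mono_neutral_left) (auto simp: not_in_keys_iff_lookup_eq_zero)

lemma augment_single [simp]: "augment (Poly_Mapping.single a x) = x"
  by (subst augment_superset[of "{a}"]) auto

lemma augment_zero [simp]: "augment 0 = 0"
  by (simp add: augment_def)

lemma augment_one [simp]: "augment (1 :: 'g::zero \<Rightarrow>\<^sub>0 'b::comm_ring_1) = 1"
  unfolding single_one[symmetric] by (rule augment_single)

lemma augment_add [simp]: "augment (p + q) = augment p + augment q"
proof -
  let ?A = "Poly_Mapping.keys p \<union> Poly_Mapping.keys q"
  have "Poly_Mapping.keys (p + q) \<subseteq> ?A" by (rule keys_add)
  then show ?thesis
    by (simp add: augment_superset[of ?A] lookup_add sum.distrib)
qed

lemma augment_mult [simp]: "augment (p * q) = augment p * augment (q :: 'g::comm_monoid_add \<Rightarrow>\<^sub>0 'b::comm_ring_1)"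
proof (induction p rule: poly_mapping_add_induct)
  case (single a x)
  show ?case
    by (induction q rule: poly_mapping_add_induct) (simp_all add: mult_single distrib_left)
qed (simp_all add: distrib_right)

definition lin_ext :: "('v \<Rightarrow> 'k::field_char_0) \<Rightarrow> 'v multiset \<Rightarrow> 'k" where
  "lin_ext l M = (\<Sum>v\<in>#M. l v)"

lemma lin_ext_simps [simp]: "lin_ext l {#} = 0" "lin_ext l {#v#} = l v" "lin_ext l (M + N) = lin_ext l M + lin_ext l N"
  by (simp_all add: lin_ext_def)

text \<open>
  The basis element \<open>(M, s)\<close> stands for \<open>x\<^sup>M z\<^sup>s\<close>.  The form comes from the bracket
  \<open>{f, g} = e\<^sup>-\<^sup>1 {e f, e g}\<close> on the elements of degree \<open>0\<close> of a log-canonical Poisson algebra with a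
  further generator \<open>e\<close>, where \<open>l\<close> is the pairing with \<open>e\<close>; the shifts \<open>Suc\<close> are due to the two factors
  \<open>e\<close>.
\<close>

definition contact_form :: "('v \<Rightarrow> 'v \<Rightarrow> 'k::field_char_0) \<Rightarrow> ('v \<Rightarrow> 'k)
    \<Rightarrow> 'v multiset \<times> nat \<Rightarrow> 'v multiset \<times> nat \<Rightarrow> 'k" where
  "contact_form w l a b = lin_ext (\<lambda>v. lin_ext (w v) (fst b)) (fst a)
     + of_nat (Suc (snd b)) * lin_ext l (fst a) - of_nat (Suc (snd a)) * lin_ext l (fst b)"

lemma lin_ext_add_fun: "lin_ext (\<lambda>v. f v + g v) M = lin_ext f M + lin_ext g M"
  by (simp add: lin_ext_def sum_mset.distrib)

lemma lin_ext_zero_fun [simp]: "lin_ext (\<lambda>v. 0) M = 0"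
  by (simp add: lin_ext_def)

lemma lin_ext_swap: "lin_ext (\<lambda>v. lin_ext (w v) N) M = lin_ext (\<lambda>u. lin_ext (\<lambda>v. w v u) M) N"
  by (induction M) (simp_all add: lin_ext_def sum_mset.distrib)

lemma lin_ext_uminus: "lin_ext (\<lambda>v. - f v) M = - lin_ext f M"
  by (induction M) (simp_all add: lin_ext_def)

text \<open>Turns a symbol into a polynomial function of the parameters \<open>l v\<close> and
  \<open>w u v\<close>, which can be prescribed freely as long as \<open>w\<close> is
  antisymmetric.\<close>

definition model_eval :: "('v \<Rightarrow> 'v \<Rightarrow> 'k::field_char_0) \<Rightarrow> ('v \<Rightarrow> 'k) \<Rightarrow> ('k, 'v) free_gpa \<Rightarrow> 'k" where
  "model_eval w l f = augment (unital_gpa.eval monoid_scale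
     (monoid_bracket (contact_form w l) ({#}, Suc 0)) (\<lambda>v. Poly_Mapping.single ({#v#}, 0) 1) f)"

context
  fixes w :: "'v \<Rightarrow> 'v \<Rightarrow> 'k::field_char_0" and l :: "'v \<Rightarrow> 'k"
  assumes alternating: "\<And>u v. w u v = - w v u"
begin

interpretation model: char0_gpa monoid_scale "monoid_bracket (contact_form w l) ({#}, Suc 0)"
proof (rule char0_gpa_monoid)
  have anti: "lin_ext (\<lambda>v. lin_ext (w v) N) M = - lin_ext (\<lambda>v. lin_ext (w v) M) N" for M N
    by (subst lin_ext_swap, subst alternating) (simp add: lin_ext_uminus)
  fix a b c :: "'v multiset \<times> nat"
  show "contact_form w l a b = - contact_form w l b a"
    unfolding contact_form_def by (subst anti) simp
  show "contact_form w l a (b + c) = contact_form w l a b + contact_form w l a c - contact_form w l a 0"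
    by (simp add: contact_form_def lin_ext_add_fun algebra_simps)
  \<comment> \<open>Write B for the form and z for \<open>({#}, Suc 0)\<close>. Adding z makes the
    factor \<open>Suc (snd b)\<close> additive, so B(a, b + c + z) = B(a, b) + B(a, c), and the
    Jacobi condition reduces to antisymmetry.\<close>
  have "lin_ext (\<lambda>v. lin_ext (w v) (fst a)) (fst b) = - lin_ext (\<lambda>v. lin_ext (w v) (fst b)) (fst a)"
    by (rule anti)
  then show "contact_form w l b c * contact_form w l a (b + c + ({#}, Suc 0)) =
    contact_form w l a b * contact_form w l (a + b + ({#}, Suc 0)) c +
    contact_form w l a c * contact_form w l b (a + c + ({#}, Suc 0))"
    by (simp add: contact_form_def lin_ext_add_fun algebra_simps)
qed

lemma model_eval_simps [simp]:
  "model_eval w l 0 = 0"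
  "model_eval w l 1 = 1"
  "model_eval w l (f + g) = model_eval w l f + model_eval w l g"
  "model_eval w l (free_scale c f) = c * model_eval w l f"
  "model_eval w l (f * g) = model_eval w l f * model_eval w l g"
  by (simp_all add: model_eval_def monoid_scale_def)

lemma model_eval_D_gen [simp]: "model_eval w l (free.D (gen v)) = l v"
  by (simp only: model_eval_def model.eval_D model.eval_simps model.D_def monoid_bracket_single
      flip: single_one) (simp add: contact_form_def)

lemma model_eval_angle_gen [simp]: "model_eval w l (free.angle (gen u) (gen v)) = w u v"
  by (simp only: model_eval_def model.eval_angle model.eval_simps model.angle_def model.D_def
      monoid_bracket_single mult_single flip: single_one single_diff)
    (simp add: contact_form_def add.commute flip: single_diff)

end

section \<open>Elements with vanishing symbol\<close>

text \<open>The polynomials in the \<open>D x\<close> and the angles of variables, an analogue of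
  the customary polynomials of Farkas for Poisson algebras.\<close>

inductive customary :: "'v set \<Rightarrow> ('k::field_char_0, 'v) free_gpa \<Rightarrow> bool" for V where
  scalar: "customary V (free_scale c 1)"
| D_gen: "v \<in> V \<Longrightarrow> customary V (free.D (gen v))"
| angle_gen: "u \<in> V \<Longrightarrow> v \<in> V \<Longrightarrow> customary V (free.angle (gen u) (gen v))"
| add: "customary V f \<Longrightarrow> customary V g \<Longrightarrow> customary V (f + g)"
| mult: "customary V f \<Longrightarrow> customary V g \<Longrightarrow> customary V (f * g)"

lemma customary_zero: "customary V 0" and customary_one: "customary V 1"
  using customary.scalar[of V 0] customary.scalar[of V 1] by simp_all

lemma customary_scale: "customary V f \<Longrightarrow> customary V (free_scale c f)"
  using customary.mult[OF customary.scalar[of V c]] by (metis free.scale_as_mult)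

lemma customary_sum: "(\<And>i. i \<in> A \<Longrightarrow> customary V (f i)) \<Longrightarrow> customary V (sum f A)"
  by (induction A rule: infinite_finite_induct) (simp_all add: customary_zero customary.add)

lemma customary_mono: "customary V f \<Longrightarrow> V \<subseteq> W \<Longrightarrow> customary W f"
  by (induction rule: customary.induct) (auto intro: customary.intros)

lemma symbol_customary: "symbol S d f q \<Longrightarrow> customary S q"
proof (induction rule: symbol.induct)
  case (mult S d f q T e g r)
  then show ?case by (auto intro: customary.mult customary_mono)
next
  case (D S d f q)
  then show ?case
    by (auto simp: vsum_def free.D_sum intro!: customary.mult customary_sum customary.D_gen)
next
  case (angle S d f q T e g r)
  then show ?case
    by (auto simp: vsum_def free.angle_sum_left free.angle_sum_right
        intro!: customary.mult customary_sum customary.angle_gen intro: customary_mono)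
qed (auto intro: customary_zero customary_one customary.add customary_scale)

context char0_gpa
begin
lemma customary_eval_cong: "customary V f \<Longrightarrow> (\<And>v. v \<in> V \<Longrightarrow> a v = b v) \<Longrightarrow> eval a f = eval b f"
  by (induction rule: customary.induct) simp_all
end

definition antisymmetric :: "('v \<Rightarrow> 'v \<Rightarrow> 'k::field_char_0) \<Rightarrow> bool" where
  "antisymmetric w \<longleftrightarrow> (\<forall>u v. w u v = - w v u)"

lemma antisymmetricD: "antisymmetric w \<Longrightarrow> w u v = - w v u"
  unfolding antisymmetric_def by blast

lemma antisymmetric_diag: "antisymmetric w \<Longrightarrow> w v v = 0"
proof -
  assume "antisymmetric w"
  then have "w v v + w v v = 0" using antisymmetricD[of w v v] by (metis add.right_inverse)
  then show ?thesis by (simp flip: mult_2)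
qed

lemma model_simps:
  assumes "antisymmetric w"
  shows "model_eval w l 0 = 0" "model_eval w l 1 = 1"
    "model_eval w l (f + g) = model_eval w l f + model_eval w l g"
    "model_eval w l (free_scale c f) = c * model_eval w l f"
    "model_eval w l (f * g) = model_eval w l f * model_eval w l g"
    "model_eval w l (free.D (gen v)) = l v"
    "model_eval w l (free.angle (gen u) (gen v)) = w u v"
  by (rule model_eval_simps model_eval_D_gen model_eval_angle_gen, rule antisymmetricD[OF assms])+

lemma model_eval_cong:
  assumes "customary V q" "antisymmetric w" "antisymmetric w'"
    and "\<And>u v. u \<in> V \<Longrightarrow> v \<in> V \<Longrightarrow> w u v = w' u v" "\<And>v. v \<in> V \<Longrightarrow> l v = l' v"
  shows "model_eval w l q = model_eval w' l' q"
  using assms(1) by induction (simp_all add: model_simps assms)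

lemma model_eval_sum: "antisymmetric w \<Longrightarrow> model_eval w l (sum f A) = (\<Sum>i\<in>A. model_eval w l (f i))"
  by (induction A rule: infinite_finite_induct) (simp_all add: model_simps)

lemma model_eval_power: "antisymmetric w \<Longrightarrow> model_eval w l (f ^ n) = model_eval w l f ^ n"
  by (induction n) (simp_all add: model_simps)

section \<open>Normal forms with respect to one variable\<close>

definition shift :: "'v \<Rightarrow> 'v \<Rightarrow> ('k::field_char_0, 'v) free_gpa \<Rightarrow> ('k, 'v) free_gpa" where
  "shift n i f = free.eval (gen(i := gen i + gen n)) f"

definition letter :: "'v \<Rightarrow> nat \<Rightarrow> ('k::field_char_0, 'v) free_gpa" where
  "letter n k = (free.D ^^ k) (gen n)"

text \<open>In the symbol calculus this substitution adds \<open>gen n\<close> to the exponent of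
  the argument \<open>i\<close>; therefore the symbol of the result contains
  \<open>shift n i\<close> of the old symbol.\<close>

definition attach :: "'v \<Rightarrow> nat \<Rightarrow> 'v \<Rightarrow> ('k::field_char_0, 'v) free_gpa \<Rightarrow> ('k, 'v) free_gpa" where
  "attach n k i f = free.eval (gen(i := free.angle (letter n k) (gen i))) f"

lemma shift_simps [simp]:
  "shift n i (f * g) = shift n i f * shift n i g"
  "shift n i (f + g) = shift n i f + shift n i g"
  "shift n i (free_scale c f) = free_scale c (shift n i f)"
  "shift n i 0 = 0" "shift n i 1 = 1"
  "shift n i (free.angle f g) = free.angle (shift n i f) (shift n i g)"
  "shift n i (free.D f) = free.D (shift n i f)"
  by (simp_all add: shift_def del: fun_upd_apply)

lemma attach_simps [simp]:
  "attach n k i (f * g) = attach n k i f * attach n k i g"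
  "attach n k i (f + g) = attach n k i f + attach n k i g"
  "attach n k i (free_scale c f) = free_scale c (attach n k i f)"
  "attach n k i 0 = 0" "attach n k i 1 = 1"
  "attach n k i (free.angle f g) = free.angle (attach n k i f) (attach n k i g)"
  "attach n k i (free.D f) = free.D (attach n k i f)"
  by (simp_all add: attach_def del: fun_upd_apply)

lemma shift_vsum:
  assumes S: "finite S"
  shows "shift n i (vsum S :: ('k::field_char_0, 'v) free_gpa) = (if i \<in> S then vsum S + gen n else vsum S)"
proof -
  have "shift n i (vsum S :: ('k, 'v) free_gpa) = (\<Sum>v\<in>S. gen v + (if v = i then gen n else 0))"
    unfolding shift_def vsum_def free.eval_sum by (rule sum.cong) auto
  then show ?thesis using S by (simp add: sum.distrib flip: vsum_def)
qed

lemma shift_id: "customary T r \<Longrightarrow> i \<notin> T \<Longrightarrow> shift n i r = r"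
  unfolding shift_def by (subst (2) eval_gen[symmetric]) (rule free.customary_eval_cong, auto)

lemma attach_id: "symbol T e g r \<Longrightarrow> i \<notin> T \<Longrightarrow> attach n k i g = g"
  unfolding attach_def by (metis free.symbol_eval_upd eval_gen)

lemma letter_Suc: "letter n (Suc k) = free.D (letter n k)"
  by (simp add: letter_def)

text \<open>If \<open>n\<close> pairs to 0 with all variables of \<open>V\<close> except
  \<open>i\<close>, the added \<open>gen n\<close> is invisible to angles between different
  variables, and the angle of \<open>gen i + gen n\<close> with itself is 0. Only \<open>D\<close>
  notices the shift.\<close>

lemma model_eval_shift:
  assumes "customary V q" "antisymmetric w" "i \<in> V" "n \<notin> V" "\<And>j. j \<in> V \<Longrightarrow> j \<noteq> i \<Longrightarrow> w n j = 0"
  shows "model_eval w l (shift n i q) = model_eval w (l(i := l i + l n)) q"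
  using assms(1)
proof induction
  case (D_gen v)
  then show ?case by (simp add: shift_def free.D_add model_simps assms)
next
  case (angle_gen u v)
  have 0: "w n j = 0" "w j n = 0" if "j \<in> V" "j \<noteq> i" for j
    using assms(5)[OF that] antisymmetricD[OF assms(2), of j n] by simp_all
  have "model_eval w l (free.angle (gen i + gen n) (gen i + gen n)) = w i i"
    using assms(2) by (simp add: free.angle_self antisymmetric_diag model_simps)
  then show ?case
    using angle_gen 0 assms(2)
    by (cases "u = i"; cases "v = i")
      (simp_all add: shift_def free.angle_add_left free.angle_add_right model_simps)
qed (simp_all add: model_simps assms)

text \<open>
  Every multilinear element in \<open>insert n S\<close> has this form: the angle bracket with \<open>D\<^sup>k n\<close> acts, up to
  terms of lower order, as a derivation of all operations, so that it can be moved to the variables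
  in \<open>S\<close>.
\<close>

inductive nform :: "'v set \<Rightarrow> 'v \<Rightarrow> nat \<Rightarrow> ('k::field_char_0, 'v) free_gpa \<Rightarrow> ('k, 'v) free_gpa \<Rightarrow> bool"
  for S n where
  prod: "symbol S e g r \<Longrightarrow> d = k + e \<Longrightarrow> f = letter n k * g \<Longrightarrow> q = free.D (gen n) ^ k * r \<Longrightarrow>
    nform S n d f q"
| attach: "symbol S e g r \<Longrightarrow> i \<in> S \<Longrightarrow> d = Suc (Suc (k + e)) \<Longrightarrow> f = attach n k i g \<Longrightarrow>
    q = free.D (gen n) ^ k * free.angle (gen n) (gen i) * shift n i r \<Longrightarrow> nform S n d f q"
| add: "nform S n d f q \<Longrightarrow> nform S n d g r \<Longrightarrow> nform S n d (f + g) (q + r)"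
| weaken: "nform S n d f q \<Longrightarrow> nform S n (Suc d) f 0"

lemma nform_finite: "nform S n d f q \<Longrightarrow> finite S"
  by (induction rule: nform.induct) (auto dest: symbol_finite)

lemma nform_scale: "nform S n d f q \<Longrightarrow> nform S n d (free_scale c f) (free_scale c q)"
proof (induction rule: nform.induct)
  case (prod e g r d k f q)
  then show ?case by (intro nform.prod[OF symbol.scale[OF prod(1), of c]]) (auto simp: free.mult_scale_right)
next
  case (attach e g r i d k f q)
  then show ?case by (intro nform.attach[OF symbol.scale[OF attach(1), of c]]) (auto simp: free.mult_scale_right)
next
  case (add d f q g r)
  then show ?case by (simp add: free.scale_right_distrib nform.add)
next
  case (weaken d f q)
  then show ?case by (simp add: nform.weaken)
qed

lemma nform_minus: "nform S n d f q \<Longrightarrow> nform S n d (- f) (- q)"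
  using nform_scale[where c = "-1"] by (simp only: free.scale_minus_left free.scale_one)

lemma nform_diff: "nform S n d f q \<Longrightarrow> nform S n d g r \<Longrightarrow> nform S n d (f - g) (q - r)"
  using nform.add[OF _ nform_minus, of S n d f q g r] by simp

lemma nform_mult:
  assumes "nform S n d f q" "symbol T e g r" "S \<inter> T = {}"
  shows "nform (S \<union> T) n (d + e) (f * g) (q * r)"
  using assms(1)
proof induction
  case (prod e' g' r' d k f q)
  then show ?case
    by (intro nform.prod[OF symbol.mult[OF prod(1) assms(2,3)]]) (auto simp: ac_simps)
next
  case (attach e' g' r' i d k f q)
  then have "i \<notin> T" using assms(3) by auto
  with attach show ?case
    by (intro nform.attach[OF symbol.mult[OF attach(1) assms(2,3)], of i])
      (auto simp: attach_id[OF assms(2)] shift_id[OF symbol_customary[OF assms(2)]] ac_simps)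
next
  case (add d f q g r)
  then show ?case by (simp add: distrib_right nform.add)
next
  case (weaken d f q)
  show ?case using nform.weaken[OF weaken.IH] by simp
qed

text \<open>On a product, \<open>D\<close> either raises the index of the letter or acts on the
  other factor. It commutes with \<open>attach\<close>, and \<open>shift\<close> supplies the
  missing \<open>gen n\<close> in \<open>vsum S\<close>.\<close>

lemma nform_D:
  assumes "nform S n d f q" "n \<notin> S"
  shows "nform S n (Suc d) (free.D f) (free.D (vsum (insert n S)) * q)"
proof -
  have v: "vsum (insert n S) = gen n + vsum S"
    using nform_finite[OF assms(1)] assms(2) by (simp add: vsum_def)
  show ?thesis
    using assms(1)
  proof induction
    case (prod e g r d k f q)
    have "nform S n (Suc d) (letter n (Suc k) * g) (free.D (gen n) ^ Suc k * r)"
      by (rule nform.prod[OF prod(1)]) (auto simp: prod)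
    moreover have "nform S n (Suc d) (letter n k * free.D g) (free.D (gen n) ^ k * (free.D (vsum S) * r))"
      by (rule nform.prod[OF symbol.D[OF prod(1)]]) (auto simp: prod)
    ultimately have "nform S n (Suc d) (letter n (Suc k) * g + letter n k * free.D g)
       (free.D (gen n) ^ Suc k * r + free.D (gen n) ^ k * (free.D (vsum S) * r))"
      by (rule nform.add)
    then show ?case
      by (simp add: prod v free.D_mult letter_Suc free.D_add algebra_simps)
  next
    case (attach e g r i d k f q)
    have "nform S n (Suc d) (attach n k i (free.D g))
      (free.D (gen n) ^ k * free.angle (gen n) (gen i) * shift n i (free.D (vsum S) * r))"
      by (rule nform.attach[OF symbol.D[OF attach(1)] attach(2)]) (auto simp: attach)
    then show ?case
      using attach symbol_finite[OF attach(1)] by (simp add: v shift_vsum ac_simps)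
  next
    case (add d f q g r)
    then show ?case by (simp add: distrib_left free.D_add nform.add)
  next
    case (weaken d f q)
    show ?case using nform.weaken[OF weaken.IH] by simp
  qed
qed

text \<open>The hypothesis \<open>core\<close> is the conclusion of
  \<open>nform_angle_letter\<close> for \<open>g\<close>. It is kept as a hypothesis because the
  induction proving that lemma uses the present one for the parts of an angle.\<close>

lemma nform_angle:
  assumes "nform S n d f q" "symbol T e g r" "S \<inter> T = {}" "n \<notin> S" "n \<notin> T"
    and core: "\<And>k. nform T n (Suc (Suc (k + e))) (free.angle (letter n k) g)
      (free.D (gen n) ^ k * free.angle (gen n) (vsum T) * r)"
  shows "nform (S \<union> T) n (Suc (Suc (d + e))) (free.angle f g)
    (free.angle (vsum (insert n S)) (vsum T) * (q * r))"
proof -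
  have v: "vsum (insert n S) = gen n + vsum S"
    using nform_finite[OF assms(1)] assms(4) by (simp add: vsum_def)
  show ?thesis
    using assms(1)
  proof induction
    case (prod e' g' r' d k f q)
    have "nform (S \<union> T) n (Suc (Suc (d + e))) (letter n k * free.angle g' g)
       (free.D (gen n) ^ k * (free.angle (vsum S) (vsum T) * (r' * r)))"
      by (rule nform.prod[OF symbol.angle[OF prod(1) assms(2,3)]]) (auto simp: prod)
    moreover have "nform (T \<union> S) n (Suc (Suc (k + e)) + e') (free.angle (letter n k) g * g')
       (free.D (gen n) ^ k * free.angle (gen n) (vsum T) * r * r')"
      by (rule nform_mult[OF core prod(1)]) (use assms(3) in auto)
    moreover have "Suc (Suc (k + e)) + e' = Suc (Suc (d + e))" "T \<union> S = S \<union> T" using prod by auto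
    ultimately have "nform (S \<union> T) n (Suc (Suc (d + e)))
       (letter n k * free.angle g' g + free.angle (letter n k) g * g')
       (free.D (gen n) ^ k * (free.angle (vsum S) (vsum T) * (r' * r))
        + free.D (gen n) ^ k * free.angle (gen n) (vsum T) * r * r')"
      using nform.add by metis
    then show ?case
      by (simp add: prod v free.angle_mult_left free.angle_add_left algebra_simps)
  next
    case (attach e' g' r' i d k f q)
    have "i \<notin> T" using attach assms(3) by auto
    have "nform (S \<union> T) n (Suc (Suc (d + e))) (attach n k i (free.angle g' g))
      (free.D (gen n) ^ k * free.angle (gen n) (gen i)
        * shift n i (free.angle (vsum S) (vsum T) * (r' * r)))"
      by (rule nform.attach[OF symbol.angle[OF attach(1) assms(2,3)]]) (auto simp: attach)
    then show ?case
      using attach symbol_finite[OF attach(1)] symbol_finite[OF assms(2)] \<open>i \<notin> T\<close>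
      by (simp add: v shift_vsum attach_id[OF assms(2)] shift_id[OF symbol_customary[OF assms(2)]] ac_simps)
  next
    case (add d f q g' r')
    then show ?case by (simp add: distrib_left distrib_right free.angle_add_left nform.add)
  next
    case (weaken d f q)
    show ?case using nform.weaken[OF weaken.IH] by simp
  qed
qed

text \<open>The angle with the letter is pushed through the operations of \<open>g\<close> by the
  derivation rules until it reaches a generator, where it is an \<open>attach\<close>.\<close>

lemma nform_angle_letter:
  fixes g :: "('k::field_char_0, 'v) free_gpa"
  assumes "symbol T e g r" "n \<notin> T"
  shows "nform T n (Suc (Suc (k + e))) (free.angle (letter n k) g)
      (free.D (gen n) ^ k * free.angle (gen n) (vsum T) * r)"
  using assms
proof (induction arbitrary: k rule: symbol.induct)
  case (zero S d)
  have "nform S n (Suc (Suc (k + d))) (letter n k * 0) (free.D (gen n) ^ k * 0)"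
    by (rule nform.prod[OF symbol.zero[OF zero(1), of "Suc (Suc d)"]]) auto
  then show ?case by simp
next
  case one
  have "nform {} n (Suc (Suc k)) (letter n k * 0) (free.D (gen n) ^ k * 0)"
    by (rule nform.prod[OF symbol.zero[of _ "Suc (Suc 0)"]]) auto
  then show ?case by simp
next
  case (gen v)
  show ?case
    by (rule nform.attach[OF symbol.gen[of v], of v _ k]) (auto simp: attach_def)
next
  case (add S d f q g r)
  then show ?case by (simp add: free.angle_add_right distrib_left nform.add)
next
  case (scale S d f q c)
  then show ?case by (simp add: free.angle_scale_right free.mult_scale_right nform_scale)
next
  case (mult S d f q T e g r)
  have "nform (S \<union> T) n (Suc (Suc (k + d)) + e) (free.angle (letter n k) f * g)
     (free.D (gen n) ^ k * free.angle (gen n) (vsum S) * q * r)"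
    by (rule nform_mult[OF mult.IH(1) mult.hyps(2,3)]) (use mult.prems in auto)
  moreover have "nform (T \<union> S) n (Suc (Suc (k + e)) + d) (free.angle (letter n k) g * f)
     (free.D (gen n) ^ k * free.angle (gen n) (vsum T) * r * q)"
    by (rule nform_mult[OF mult.IH(2) mult.hyps(1)]) (use mult.prems mult.hyps(3) in auto)
  moreover have "Suc (Suc (k + d)) + e = Suc (Suc (k + (d + e)))"
    "Suc (Suc (k + e)) + d = Suc (Suc (k + (d + e)))" "T \<union> S = S \<union> T" by auto
  ultimately have "nform (S \<union> T) n (Suc (Suc (k + (d + e))))
     (free.angle (letter n k) f * g + free.angle (letter n k) g * f)
     (free.D (gen n) ^ k * free.angle (gen n) (vsum S) * q * r
      + free.D (gen n) ^ k * free.angle (gen n) (vsum T) * r * q)"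
    using nform.add by metis
  then show ?case
    using mult.hyps
    by (simp add: free.angle_mult_right free.angle_add_right vsum_Un symbol_finite algebra_simps)
next
  case (D S d f q)
  have v: "vsum (insert n S) = gen n + vsum S"
    using symbol_finite[OF D.hyps] D.prems by (simp add: vsum_def)
  \<comment> \<open>Here <a, D f> = D <a, f> - <D a, f>. The second term needs the induction
    hypothesis for the next letter, hence the arbitrary \<open>k\<close>.\<close>
  have "nform S n (Suc (Suc (Suc (k + d)))) (free.D (free.angle (letter n k) f) - free.angle (letter n (Suc k)) f)
     (free.D (vsum (insert n S)) * (free.D (gen n) ^ k * free.angle (gen n) (vsum S) * q)
      - free.D (gen n) ^ Suc k * free.angle (gen n) (vsum S) * q)"
    using nform_diff[OF nform_D[OF D.IH[OF D.prems, of k] D.prems], of "free.angle (letter n (Suc k)) f"]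
      D.IH[OF D.prems, of "Suc k"] by simp
  then show ?case
    by (simp add: free.D_angle letter_Suc v free.D_add algebra_simps)
next
  case (angle S d f q T e g r)
  have nS: "n \<notin> S" and nT: "n \<notin> T" using angle.prems by auto
  have vS: "vsum (insert n S) = gen n + vsum S" and vT: "vsum (insert n T) = gen n + vsum T"
    using symbol_finite[OF angle.hyps(1)] symbol_finite[OF angle.hyps(2)] nS nT by (simp_all add: vsum_def)
  have TS: "T \<union> S = S \<union> T" "T \<inter> S = {}" using angle.hyps(3) by auto
  let ?a = "letter n k" and ?c = "free.D (gen n) ^ k" and ?N = "Suc (Suc (k + Suc (Suc (d + e))))"
  have 1: "nform (S \<union> T) n ?N (free.angle (free.angle ?a f) g)
    (free.angle (gen n + vsum S) (vsum T) * (?c * free.angle (gen n) (vsum S) * q * r))"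
    using nform_angle[OF angle.IH(1)[OF nS, of k] angle.hyps(2,3) nS nT angle.IH(2)[OF nT]]
    by (simp add: vS add.assoc)
  have 2: "nform (S \<union> T) n ?N (- free.angle (free.angle ?a g) f)
    (- (free.angle (gen n + vsum T) (vsum S) * (?c * free.angle (gen n) (vsum T) * r * q)))"
    using nform_minus[OF nform_angle[OF angle.IH(2)[OF nT, of k] angle.hyps(1) TS(2) nT nS angle.IH(1)[OF nS]]]
    by (simp add: vT TS ac_simps)
  \<comment> \<open>The corrections 3, 4, 5 in the Jacobi identity have order one less than
    \<open>?N\<close> and get the symbol 0 by \<open>weaken\<close>.\<close>
  have 3: "nform (S \<union> T) n ?N (letter n (Suc k) * free.angle f g) 0"
    by (rule nform.weaken, rule nform.prod[OF symbol.angle[OF angle.hyps]]) auto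
  have 4: "nform (S \<union> T) n ?N (free.angle ?a g * free.D f) 0"
    using nform.weaken[OF nform_mult[OF angle.IH(2)[OF nT, of k] symbol.D[OF angle.hyps(1)] TS(2)]]
    by (simp add: TS ac_simps)
  have 5: "nform (S \<union> T) n ?N (free.angle ?a f * free.D g) 0"
    using nform.weaken[OF nform_mult[OF angle.IH(1)[OF nS, of k] symbol.D[OF angle.hyps(2)] angle.hyps(3)]]
    by (simp add: ac_simps)
  have F: "free.angle ?a (free.angle f g) = free.angle (free.angle ?a f) g - free.angle (free.angle ?a g) f
    + letter n (Suc k) * free.angle f g - free.angle ?a g * free.D f + free.angle ?a f * free.D g"
    unfolding letter_Suc free.angle_jacobi[of ?a f g] free.angle_anticomm[of f "free.angle ?a g"]
    by (simp add: mult.commute)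
  \<comment> \<open>In the sum of the symbols of 1 and 2 the terms with <n, S><n, T> cancel. What
    remains is <S, T>(<n, S> + <n, T>), the required symbol.\<close>
  have anti: "free.angle (vsum T) (vsum S) = - free.angle (vsum S) (vsum T :: ('k, 'v) free_gpa)"
    by (rule free.angle_anticomm)
  from nform.add[OF nform_diff[OF nform.add[OF nform.add[OF 1 2] 3] 4] 5]
  show ?case
    unfolding F
    using symbol_finite[OF angle.hyps(1)] symbol_finite[OF angle.hyps(2)] angle.hyps(3)
    by (simp add: vsum_Un free.angle_add_left free.angle_add_right anti algebra_simps)
next
  case (weaken S d f q)
  show ?case using nform.weaken[OF weaken.IH[OF weaken.prems, of k]] by simp
qed

text \<open>At the leaf \<open>n\<close> the normal form is \<open>letter n 0\<close>; every
  operation above it is absorbed by \<open>nform_mult\<close>, \<open>nform_D\<close> or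
  \<open>nform_angle\<close>, after exchanging the arguments if \<open>n\<close> is in the second
  one.\<close>

lemma nform_symbol:
  assumes "symbol S d f q" "n \<in> S"
  shows "nform (S - {n}) n d f q"
  using assms
proof (induction rule: symbol.induct)
  case (zero S d)
  have "nform (S - {n}) n d (letter n 0 * 0) (free.D (gen n) ^ 0 * 0)"
    by (rule nform.prod[OF symbol.zero[of _ d]]) (use zero in auto)
  then show ?case by simp
next
  case (gen v)
  then have "{v} - {n} = {}" "v = n" by auto
  then show ?case
    by (simp only:) (rule nform.prod[OF symbol.one, of _ 0], auto simp: letter_def)
next
  case (mult S d f q T e g r)
  show ?case
  proof (cases "n \<in> S")
    case True
    then have "n \<notin> T" "S \<union> T - {n} = (S - {n}) \<union> T" using mult.hyps by auto
    then show ?thesis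
      using nform_mult[OF mult.IH(1)[OF True] mult.hyps(2)] mult.hyps(3) by auto
  next
    case False
    then have "n \<in> T" "S \<union> T - {n} = (T - {n}) \<union> S" using mult by auto
    then show ?thesis
      using nform_mult[OF mult.IH(2) mult.hyps(1)] mult.hyps(3) by (auto simp: ac_simps)
  qed
next
  case (D S d f q)
  then show ?case using nform_D[OF D.IH[OF D.prems]] by (simp add: insert_absorb)
next
  case (angle S d f q T e g r)
  show ?case
  proof (cases "n \<in> S")
    case True
    then have n: "n \<notin> T" "S \<union> T - {n} = (S - {n}) \<union> T" using angle.hyps by auto
    then show ?thesis
      using nform_angle[OF angle.IH(1)[OF True] angle.hyps(2) _ _ n(1) nform_angle_letter[OF angle.hyps(2) n(1)]]
        angle.hyps(3) True by (auto simp: insert_absorb)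
  next
    case False
    then have n: "n \<in> T" "S \<union> T - {n} = (T - {n}) \<union> S" using angle by auto
    have "nform ((T - {n}) \<union> S) n (Suc (Suc (e + d))) (free.angle g f)
       (free.angle (vsum (insert n (T - {n}))) (vsum S) * (r * q))"
      by (rule nform_angle[OF angle.IH(2)[OF n(1)] angle.hyps(1) _ _ False nform_angle_letter[OF angle.hyps(1) False]])
       (use angle.hyps(3) in auto)
    from nform_minus[OF this] show ?thesis
      unfolding free.angle_anticomm[of f g] free.angle_anticomm[of "vsum S" "vsum T"]
      using n by (simp add: insert_absorb ac_simps)
  qed
qed (auto intro: nform.add nform_scale nform.weaken)

text \<open>Terms with the same \<open>k\<close>, or with the same \<open>k\<close> and
  \<open>i\<close>, are merged so that coefficients can be compared. The bound
  \<open>k < d - 1\<close> means \<open>k + 2 \<le> d\<close>; by truncated subtraction it excludes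
  all \<open>k\<close> if \<open>d \<le> 1\<close>.\<close>

lemma nform_families:
  fixes f :: "('k::field_char_0, 'v) free_gpa"
  assumes "nform S n d f q"
  shows "\<exists>g r h t. (\<forall>k\<le>d. symbol S (d - k) (g k) (r k)) \<and>
    (\<forall>k<d - 1. \<forall>i\<in>S. symbol S (d - 2 - k) (h k i) (t k i)) \<and>
    f = (\<Sum>k\<le>d. letter n k * g k) + (\<Sum>k<d - 1. \<Sum>i\<in>S. attach n k i (h k i)) \<and>
    q = (\<Sum>k\<le>d. free.D (gen n) ^ k * r k)
      + (\<Sum>k<d - 1. \<Sum>i\<in>S. free.D (gen n) ^ k * free.angle (gen n) (gen i) * shift n i (t k i))"
  using assms
proof induction
  case (prod e g r d k f q)
  have fin: "finite S" using symbol_finite[OF prod(1)] .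
  show ?case
    by (rule exI[of _ "\<lambda>j. if j = k then g else 0"], rule exI[of _ "\<lambda>j. if j = k then r else 0"],
        rule exI[of _ "\<lambda>j i. 0"], rule exI[of _ "\<lambda>j i. 0"])
      (use prod fin in \<open>auto simp: if_distrib[where f = "(*) _"] symbol.zero cong: if_cong\<close>)
next
  case (attach e g r i d k f q)
  have fin: "finite S" using symbol_finite[OF attach(1)] .
  have k: "k < d - 1" using attach by auto
  have pick: "(\<Sum>j<d - 1. \<Sum>l\<in>S. if j = k \<and> l = i then x else 0) = x" for x :: "('k, 'v) free_gpa"
  proof -
    have "(\<Sum>j<d - 1. \<Sum>l\<in>S. if j = k \<and> l = i then x else 0)
      = (\<Sum>j<d - 1. if j = k then (\<Sum>l\<in>S. if l = i then x else 0) else 0)"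
      by (rule sum.cong) auto
    then show ?thesis using k fin attach(2) by simp
  qed
  have "(\<Sum>j<d - 1. \<Sum>l\<in>S. attach n j l (if j = k \<and> l = i then g else 0))
      = (\<Sum>j<d - 1. \<Sum>l\<in>S. if j = k \<and> l = i then f else 0)"
    using attach by (intro sum.cong) auto
  moreover have "(\<Sum>j<d - 1. \<Sum>l\<in>S. free.D (gen n) ^ j * free.angle (gen n) (gen l)
       * shift n l (if j = k \<and> l = i then r else 0))
      = (\<Sum>j<d - 1. \<Sum>l\<in>S. if j = k \<and> l = i then q else 0)"
    using attach by (intro sum.cong) auto
  moreover have "symbol S (d - 2 - j) (if j = k \<and> l = i then g else 0) (if j = k \<and> l = i then r else 0)"
    for j l
    using attach symbol.zero[OF fin] by auto
  ultimately show ?case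
    by - (rule exI[of _ "\<lambda>j. 0"], rule exI[of _ "\<lambda>j. 0"],
        rule exI[of _ "\<lambda>j l. if j = k \<and> l = i then g else 0"],
        rule exI[of _ "\<lambda>j l. if j = k \<and> l = i then r else 0"],
        simp only: pick mult_zero_right sum.neutral_const add_0 simp_thms symbol.zero[OF fin], simp)
next
  case (add d f q f' q')
  then obtain g r h t g' r' h' t' where
    "\<forall>k\<le>d. symbol S (d - k) (g k) (r k)" "\<forall>k<d - 1. \<forall>i\<in>S. symbol S (d - 2 - k) (h k i) (t k i)"
    "f = (\<Sum>k\<le>d. letter n k * g k) + (\<Sum>k<d - 1. \<Sum>i\<in>S. attach n k i (h k i))"
    "q = (\<Sum>k\<le>d. free.D (gen n) ^ k * r k)
      + (\<Sum>k<d - 1. \<Sum>i\<in>S. free.D (gen n) ^ k * free.angle (gen n) (gen i) * shift n i (t k i))"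
    "\<forall>k\<le>d. symbol S (d - k) (g' k) (r' k)" "\<forall>k<d - 1. \<forall>i\<in>S. symbol S (d - 2 - k) (h' k i) (t' k i)"
    "f' = (\<Sum>k\<le>d. letter n k * g' k) + (\<Sum>k<d - 1. \<Sum>i\<in>S. attach n k i (h' k i))"
    "q' = (\<Sum>k\<le>d. free.D (gen n) ^ k * r' k)
      + (\<Sum>k<d - 1. \<Sum>i\<in>S. free.D (gen n) ^ k * free.angle (gen n) (gen i) * shift n i (t' k i))"
    by blast
  note * = this
  show ?case
  proof (rule exI[of _ "\<lambda>k. g k + g' k"], rule exI[of _ "\<lambda>k. r k + r' k"],
      rule exI[of _ "\<lambda>k i. h k i + h' k i"], rule exI[of _ "\<lambda>k i. t k i + t' k i"], intro conjI)
    show "\<forall>k\<le>d. symbol S (d - k) (g k + g' k) (r k + r' k)"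
      using *(1,5) by (simp add: symbol.add)
    show "\<forall>k<d - 1. \<forall>i\<in>S. symbol S (d - 2 - k) (h k i + h' k i) (t k i + t' k i)"
      using *(2,6) by (simp add: symbol.add)
  qed (simp_all add: *(3,4,7,8) distrib_left sum.distrib)
next
  case (weaken d f q)
  then obtain g r h t where *:
    "\<forall>k\<le>d. symbol S (d - k) (g k) (r k)" "\<forall>k<d - 1. \<forall>i\<in>S. symbol S (d - 2 - k) (h k i) (t k i)"
    "f = (\<Sum>k\<le>d. letter n k * g k) + (\<Sum>k<d - 1. \<Sum>i\<in>S. attach n k i (h k i))"
    by blast
  have fin: "finite S" using nform_finite[OF weaken.hyps] .
  \<comment> \<open>The larger order admits one more index in each family; the new places are filled
    with 0.\<close>
  let ?g = "\<lambda>k. if k \<le> d then g k else 0" and ?h = "\<lambda>k i. if k < d - 1 then h k i else 0"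
  have "symbol S (Suc d - k) (?g k) 0" if "k \<le> Suc d" for k
    using * that symbol.weaken[of S "d - k" "g k" "r k"] symbol.zero[OF fin]
    by (auto simp: Suc_diff_le)
  moreover have "symbol S (Suc d - 2 - k) (?h k i) 0" if "k < Suc d - 1" "i \<in> S" for k i
  proof (cases "k < d - 1")
    case True
    then have "Suc d - 2 - k = Suc (d - 2 - k)" by auto
    then show ?thesis using * True that symbol.weaken by fastforce
  qed (use symbol.zero[OF fin] in auto)
  moreover have "(\<Sum>k\<le>d. letter n k * g k) = (\<Sum>k\<le>Suc d. letter n k * ?g k)"
    by simp
  moreover have "(\<Sum>k<d - 1. \<Sum>i\<in>S. attach n k i (h k i)) = (\<Sum>k<Suc d - 1. \<Sum>i\<in>S. attach n k i (?h k i))"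
    by (rule sum.mono_neutral_cong_left) auto
  ultimately show ?case
    unfolding *(3)
    by - (rule exI[of _ ?g], rule exI[of _ "\<lambda>k. 0"], rule exI[of _ ?h], rule exI[of _ "\<lambda>k i. 0"],
        simp del: sum.atMost_Suc)
qed

section \<open>Orders, and their descent when the symbol vanishes\<close>

definition bounded_order :: "'v set \<Rightarrow> nat \<Rightarrow> ('k::field_char_0, 'v) free_gpa \<Rightarrow> bool" where
  "bounded_order S d f \<longleftrightarrow> (\<exists>q. symbol S d f q)"

lemma bounded_order_add: "bounded_order S d f \<Longrightarrow> bounded_order S d g \<Longrightarrow> bounded_order S d (f + g)"
  unfolding bounded_order_def by (blast intro: symbol.add)
lemma bounded_order_zero: "finite S \<Longrightarrow> bounded_order S d 0"
  unfolding bounded_order_def by (blast intro: symbol.zero)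
lemma bounded_order_sum:
  "finite S \<Longrightarrow> (\<And>i. i \<in> A \<Longrightarrow> bounded_order S d (f i)) \<Longrightarrow> bounded_order S d (sum f A)"
  by (induction A rule: infinite_finite_induct) (simp_all add: bounded_order_zero bounded_order_add)
lemma bounded_order_mult: "bounded_order S d f \<Longrightarrow> bounded_order T e g \<Longrightarrow> S \<inter> T = {} \<Longrightarrow>
  bounded_order (S \<union> T) (d + e) (f * g)"
  unfolding bounded_order_def by (blast intro: symbol.mult)
lemma bounded_order_angle: "bounded_order S d f \<Longrightarrow> bounded_order T e g \<Longrightarrow> S \<inter> T = {} \<Longrightarrow>
  bounded_order (S \<union> T) (Suc (Suc (d + e))) (free.angle f g)"
  unfolding bounded_order_def by (blast intro: symbol.angle)
lemma bounded_order_D: "bounded_order S d f \<Longrightarrow> bounded_order S (Suc d) (free.D f)"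
  unfolding bounded_order_def by (blast intro: symbol.D)
lemma bounded_order_Suc: "bounded_order S d f \<Longrightarrow> bounded_order S (Suc d) f"
  unfolding bounded_order_def by (blast intro: symbol.weaken)
lemma bounded_order_mono: "bounded_order S d f \<Longrightarrow> d \<le> e \<Longrightarrow> bounded_order S e f"
proof (induction e)
  case (Suc e)
  then show ?case using bounded_order_Suc by (cases "d = Suc e") auto
qed simp
lemma bounded_order_scale: "bounded_order S d f \<Longrightarrow> bounded_order S d (free_scale c f)"
  unfolding bounded_order_def by (blast intro: symbol.scale)
lemma bounded_order_letter: "bounded_order {n} k (letter n k)"
proof (induction k)
  case 0
  show ?case unfolding bounded_order_def letter_def using symbol.gen[of n] by auto
qed (simp add: letter_Suc bounded_order_D)

lemma bounded_order_attach:
  assumes "symbol S e g r" "i \<in> S" "n \<notin> S"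
  shows "bounded_order (insert n S) (Suc (Suc (k + e))) (attach n k i g)"
  using assms
proof (induction rule: symbol.induct)
  case (zero S d)
  then show ?case by (simp add: bounded_order_zero)
next
  case (gen v)
  have "bounded_order ({n} \<union> {v}) (Suc (Suc (k + 0))) (free.angle (letter n k) (gen v))"
    by (rule bounded_order_angle[OF bounded_order_letter])
      (use gen symbol.gen[of v] in \<open>auto simp: bounded_order_def\<close>)
  then show ?case using gen by (simp add: attach_def insert_commute)
next
  case (mult S d f q T e g r)
  have b: "bounded_order S d f" "bounded_order T e g" using mult.hyps bounded_order_def by blast+
  show ?case
  proof (cases "i \<in> S")
    case True
    then have "i \<notin> T" using mult.hyps by auto
    then show ?thesis
      using bounded_order_mult[OF mult.IH(1)[OF True] b(2)] mult.prems mult.hyps(3)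
      by (simp add: attach_id[OF mult.hyps(2)] add.assoc)
  next
    case False
    then show ?thesis
      using bounded_order_mult[OF b(1) mult.IH(2)] mult.prems mult.hyps(3)
      by (simp add: attach_id[OF mult.hyps(1)] ac_simps)
  qed
next
  case (angle S d f q T e g r)
  have b: "bounded_order S d f" "bounded_order T e g" using angle.hyps bounded_order_def by blast+
  show ?case
  proof (cases "i \<in> S")
    case True
    then have "i \<notin> T" using angle.hyps by auto
    then show ?thesis
      using bounded_order_angle[OF angle.IH(1)[OF True] b(2)] angle.prems angle.hyps(3)
      by (simp add: attach_id[OF angle.hyps(2)] add.assoc)
  next
    case False
    then show ?thesis
      using bounded_order_angle[OF b(1) angle.IH(2)] angle.prems angle.hyps(3)
      by (simp add: attach_id[OF angle.hyps(1)] ac_simps)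
  qed
next
  case (D S d f q)
  then show ?case by (simp add: bounded_order_D)
next
  case (weaken S d f q)
  then show ?case by (simp add: bounded_order_Suc)
qed (auto intro: bounded_order_add bounded_order_scale)

text \<open>Vanishing as a polynomial function of the parameters \<open>l\<close> and
  \<open>w\<close>. An element that is not null is nonzero, since evaluation sends 0 to 0.\<close>

definition null :: "('k::field_char_0, 'v) free_gpa \<Rightarrow> bool" where
  "null q \<longleftrightarrow> (\<forall>w l. antisymmetric w \<longrightarrow> model_eval w l q = 0)"

lemma poly_coeffs_zero:
  fixes c :: "nat \<Rightarrow> 'k::field_char_0"
  assumes "\<And>t. (\<Sum>k\<le>d. t ^ k * c k) = 0" "k \<le> d"
  shows "c k = 0"
proof -
  let ?p = "\<Sum>k\<le>d. monom (c k) k"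
  have "poly ?p t = 0" for t
    using assms(1)[of t] by (simp add: poly_sum poly_monom mult.commute)
  then have "?p = 0" using poly_all_0_iff_0 by blast
  then have "coeff ?p k = 0" by simp
  then show ?thesis using assms(2) by (simp add: coeff_sum)
qed

text \<open>The \<open>r k\<close> and \<open>t k i\<close> live in variables other than
  \<open>n\<close>, so the parameters at \<open>n\<close> can be varied independently. Setting all
  \<open>w n j\<close> to 0 isolates the \<open>r k\<close>. Once these are null,
  \<open>w n i = 1\<close> with all other \<open>w n j = 0\<close> isolates the
  \<open>t k i\<close>. In both cases the powers of \<open>l n\<close> are separated because a
  polynomial with only zero values over an infinite field is 0.\<close>

lemma null_families:
  fixes r :: "nat \<Rightarrow> ('k::field_char_0, 'v) free_gpa"
  assumes r: "\<And>k. k \<le> d \<Longrightarrow> customary S (r k)"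
    and t: "\<And>k i. k < e \<Longrightarrow> i \<in> S \<Longrightarrow> customary S (t k i)" and "finite S" "n \<notin> S"
    and null: "null ((\<Sum>k\<le>d. free.D (gen n) ^ k * r k)
      + (\<Sum>k<e. \<Sum>i\<in>S. free.D (gen n) ^ k * free.angle (gen n) (gen i) * shift n i (t k i)))"
  shows "\<forall>k\<le>d. null (r k)" and "\<forall>k<e. \<forall>i\<in>S. null (t k i)"
proof -
  have expand: "(\<Sum>k\<le>d. l n ^ k * model_eval w l (r k))
      + (\<Sum>k<e. \<Sum>i\<in>S. l n ^ k * w n i * model_eval w l (shift n i (t k i))) = 0"
    if "antisymmetric w" for w l
    using null that by (simp add: null_def model_simps model_eval_sum model_eval_power)
  have r0: "model_eval w l (r k) = 0" if w: "antisymmetric w" and "k \<le> d" for w l k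
  proof (rule poly_coeffs_zero[OF _ \<open>k \<le> d\<close>])
    fix \<tau>
    let ?w = "\<lambda>u v. if u = n \<or> v = n then 0 else w u v"
    have w': "antisymmetric ?w"
      unfolding antisymmetric_def by (auto intro: antisymmetricD[OF w])
    have "model_eval ?w (l(n := \<tau>)) (r k) = model_eval w l (r k)" if "k \<le> d" for k
      by (rule model_eval_cong[OF r[OF that] w' w]) (use \<open>n \<notin> S\<close> in auto)
    then show "(\<Sum>k\<le>d. \<tau> ^ k * model_eval w l (r k)) = 0"
      using expand[OF w', of "l(n := \<tau>)"] by simp
  qed
  then show "\<forall>k\<le>d. null (r k)" by (simp add: null_def)
  have "model_eval w l (t k i) = 0" if w: "antisymmetric w" and "k < e" and i: "i \<in> S" for w l k i
  proof -
    have in_range: "k \<le> e - 1" and e: "{..e - 1} = {..<e}" using \<open>k < e\<close> by auto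
    show ?thesis
    proof (rule poly_coeffs_zero[OF _ in_range])
      fix \<tau>
      \<comment> \<open>only the terms attached at \<open>i\<close> survive; the shift of \<open>l i\<close> undoes the substitution in \<open>t k i\<close>\<close>
      let ?w = "\<lambda>u v. if u = n then (if v = i then 1 else 0) else if v = n then (if u = i then - 1 else 0) else w u v"
      let ?l = "l(n := \<tau>, i := l i - \<tau>)"
      have "n \<noteq> i" using i \<open>n \<notin> S\<close> by auto
      then have w': "antisymmetric ?w"
        unfolding antisymmetric_def by (auto intro: antisymmetricD[OF w])
      have t_eval: "model_eval ?w ?l (shift n i (t k i)) = model_eval w l (t k i)" if "k < e" for k
      proof -
        have "model_eval ?w ?l (shift n i (t k i)) = model_eval ?w (?l(i := ?l i + ?l n)) (t k i)"
          by (rule model_eval_shift[OF t[OF that i] w' i \<open>n \<notin> S\<close>]) auto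
        also have "\<dots> = model_eval w l (t k i)"
          by (rule model_eval_cong[OF t[OF that i] w' w]) (use \<open>n \<notin> S\<close> in auto)
        finally show ?thesis .
      qed
      have "(\<Sum>k<e. \<Sum>j\<in>S. ?l n ^ k * ?w n j * model_eval ?w ?l (shift n j (t k j)))
        = (\<Sum>k<e. \<tau> ^ k * model_eval w l (t k i))"
      proof (rule sum.cong)
        fix k assume "k \<in> {..<e}"
        have "(\<Sum>j\<in>S. ?l n ^ k * ?w n j * model_eval ?w ?l (shift n j (t k j)))
          = (\<Sum>j\<in>S. if j = i then \<tau> ^ k * model_eval ?w ?l (shift n i (t k i)) else 0)"
          using \<open>n \<noteq> i\<close> by (intro sum.cong) auto
        then show "(\<Sum>j\<in>S. ?l n ^ k * ?w n j * model_eval ?w ?l (shift n j (t k j)))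
          = \<tau> ^ k * model_eval w l (t k i)"
          using \<open>finite S\<close> i t_eval \<open>k \<in> {..<e}\<close> by simp
      qed simp
      then show "(\<Sum>k\<le>e - 1. \<tau> ^ k * model_eval w l (t k i)) = 0"
        using expand[OF w', of ?l] r0[OF w'] e by simp
    qed
  qed
  then show "\<forall>k<e. \<forall>i\<in>S. null (t k i)" by (simp add: null_def)
qed

lemma symbol_empty:
  "symbol S d f q \<Longrightarrow> S = {} \<Longrightarrow> \<exists>c. f = free_scale c 1 \<and> (d = 0 \<longrightarrow> q = free_scale c 1)"
proof (induction rule: symbol.induct)
  case (zero S d)
  then show ?case by (intro exI[of _ 0]) simp
next
  case one
  show ?case by (intro exI[of _ 1]) simp
next
  case (add S d f q g r)
  then obtain c1 c2 where "f = free_scale c1 1 \<and> (d = 0 \<longrightarrow> q = free_scale c1 1)"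
    "g = free_scale c2 1 \<and> (d = 0 \<longrightarrow> r = free_scale c2 1)" by blast
  then show ?case by (intro exI[of _ "c1 + c2"]) (simp add: free.scale_left_distrib)
next
  case (scale S d f q c)
  then obtain c1 where "f = free_scale c1 1 \<and> (d = 0 \<longrightarrow> q = free_scale c1 1)" by blast
  then show ?case by (intro exI[of _ "c * c1"]) simp
next
  case (mult S d f q T e g r)
  then obtain c1 c2 where "f = free_scale c1 1 \<and> (d = 0 \<longrightarrow> q = free_scale c1 1)"
    "g = free_scale c2 1 \<and> (e = 0 \<longrightarrow> r = free_scale c2 1)" by blast
  then show ?case
    by (intro exI[of _ "c1 * c2"]) (simp add: free.scale_mult[symmetric] free.mult_scale_right mult.commute)
next
  case (D S d f q)
  then obtain c1 where "f = free_scale c1 1" by blast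
  then show ?case by (intro exI[of _ 0]) (simp add: free.D_scale free.D_one)
next
  case (angle S d f q T e g r)
  then obtain c1 where "f = free_scale c1 1" by blast
  then show ?case by (intro exI[of _ 0]) (simp add: free.angle_scale_left)
next
  case (weaken S d f q)
  then show ?case by auto
qed simp

text \<open>Induction on the number of variables. By \<open>null_families\<close> all coefficients
  of the normal form have null symbols, so their orders drop; putting back \<open>letter n k\<close>
  or \<open>attach n k i\<close> costs \<open>k\<close> or \<open>k + 2\<close>, as before. For
  \<open>d = 0\<close> only the coefficient \<open>g 0\<close> exists. The case distinction stands
  for a negative order, which only 0 has.\<close>

lemma null_symbol:
  fixes f :: "('k::field_char_0, 'v) free_gpa"
  assumes "symbol S d f q" "null q"
  shows "if d = 0 then f = 0 else bounded_order S (d - 1) f"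
proof -
  have "finite S" using symbol_finite[OF assms(1)] .
  then show ?thesis
    using assms
  proof (induction S arbitrary: d f q rule: finite_induct)
    case empty
    then obtain c where c: "f = free_scale c 1" "d = 0 \<longrightarrow> q = free_scale c 1"
      using symbol_empty by blast
    have w: "antisymmetric (\<lambda>(u::'v) (v::'v). 0 :: 'k)" by (simp add: antisymmetric_def)
    have "model_eval (\<lambda>u v. 0) (\<lambda>v. 0) q = 0"
      using empty.prems(2) w unfolding null_def by blast
    then have "c = 0" if "d = 0"
      using c(2) that by (simp add: model_simps[OF w])
    moreover have "bounded_order {} (d - 1) f"
      unfolding c(1)
      by (rule bounded_order_scale, rule bounded_order_mono[of _ 0]) (use symbol.one in \<open>auto simp: bounded_order_def\<close>)
    ultimately show ?case using c by auto
  next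
    case (insert n S)
    have "nform (insert n S - {n}) n d f q" by (rule nform_symbol[OF insert.prems(1)]) simp
    then have "nform S n d f q" using insert.hyps by simp
    from nform_families[OF this] obtain g r h t where *:
      "\<And>k. k \<le> d \<Longrightarrow> symbol S (d - k) (g k) (r k)"
      "\<And>k i. k < d - 1 \<Longrightarrow> i \<in> S \<Longrightarrow> symbol S (d - 2 - k) (h k i) (t k i)"
      "f = (\<Sum>k\<le>d. letter n k * g k) + (\<Sum>k<d - 1. \<Sum>i\<in>S. attach n k i (h k i))"
      "q = (\<Sum>k\<le>d. free.D (gen n) ^ k * r k)
      + (\<Sum>k<d - 1. \<Sum>i\<in>S. free.D (gen n) ^ k * free.angle (gen n) (gen i) * shift n i (t k i))"
      by blast
    have null_r: "\<forall>k\<le>d. null (r k)" and null_t: "\<forall>k<d - 1. \<forall>i\<in>S. null (t k i)"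
      using null_families[OF symbol_customary[OF *(1)] symbol_customary[OF *(2)] insert.hyps insert.prems(2)[unfolded *(4)]]
      by blast+
    show ?case
    proof (cases "d = 0")
      case True
      then have "g 0 = 0" using insert.IH[OF *(1)[of 0]] null_r by simp
      then show ?thesis using True *(3) by simp
    next
      case False
      have 1: "bounded_order (insert n S) (d - 1) (letter n k * g k)" if "k \<le> d" for k
      proof (cases "d - k = 0")
        case True
        then show ?thesis
          using insert.IH[OF *(1)[OF that]] null_r that insert.hyps by (simp add: bounded_order_zero)
      next
        case False
        then have "bounded_order S (d - k - 1) (g k)"
          using insert.IH[OF *(1)[OF that]] null_r that by simp
        from bounded_order_mult[OF bounded_order_letter this, of n k] show ?thesis
          using False that insert.hyps by simp
      qed
      have 2: "bounded_order (insert n S) (d - 1) (attach n k i (h k i))" if "k < d - 1" "i \<in> S" for k i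
      proof (cases "d - 2 - k = 0")
        case True
        then show ?thesis
          using insert.IH[OF *(2)[OF that]] null_t that insert.hyps by (simp add: bounded_order_zero)
      next
        case False
        note ki = that
        obtain r' where r': "symbol S (d - 2 - k - 1) (h k i) r'"
          using insert.IH[OF *(2)[OF ki]] null_t ki False by (auto simp: bounded_order_def)
        \<comment> \<open>The case assumption keeps the last subtraction from being
          truncated.\<close>
        have "Suc (Suc (k + (d - 2 - k - 1))) = d - 1" using False by auto
        then show ?thesis
          using bounded_order_attach[OF r' \<open>i \<in> S\<close> insert.hyps(2), of k] by (simp only:)
      qed
      show ?thesis
        unfolding *(3) if_not_P[OF False]
      proof (rule bounded_order_add; rule bounded_order_sum)
        show "bounded_order (insert n S) (d - 1) (\<Sum>i\<in>S. attach n k i (h k i))" if "k \<in> {..<d - 1}" for k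
          by (rule bounded_order_sum) (use 2 that insert.hyps in auto)
      qed (use 1 insert.hyps in auto)
    qed
  qed
qed

lemma bounded_order_nonnull_symbol:
  "bounded_order S d f \<Longrightarrow> f \<noteq> 0 \<Longrightarrow> \<exists>d q. symbol S d f q \<and> \<not> null q"
proof (induction d)
  case 0
  then obtain q where "symbol S 0 f q" by (auto simp: bounded_order_def)
  moreover from this 0(2) have "\<not> null q" using null_symbol[of S 0 f q] by auto
  ultimately show ?case by blast
next
  case (Suc d)
  then obtain q where q: "symbol S (Suc d) f q" by (auto simp: bounded_order_def)
  show ?case
  proof (cases "null q")
    case True
    then show ?thesis using null_symbol[OF q] Suc by simp
  next
    case False
    then show ?thesis using q by blast
  qed
qed

section \<open>Homogeneous components and linearization\<close>

text \<open>
  All multihomogeneous elements for \<open>full = True\<close>, only the customary ones for \<open>full = False\<close>.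
\<close>

inductive homog :: "bool \<Rightarrow> 'v multiset \<Rightarrow> ('k::field_char_0, 'v) free_gpa \<Rightarrow> bool" for full where
  zero: "homog full M 0"
| add: "homog full M f \<Longrightarrow> homog full M g \<Longrightarrow> homog full M (f + g)"
| scale: "homog full M f \<Longrightarrow> homog full M (free_scale c f)"
| one: "homog full {#} 1"
| D_gen: "homog full {#v#} (free.D (gen v))"
| angle_gen: "homog full {#u, v#} (free.angle (gen u) (gen v))"
| mult: "homog full M f \<Longrightarrow> homog full N g \<Longrightarrow> homog full (M + N) (f * g)"
| gen: "full \<Longrightarrow> homog full {#v#} (gen v)"
| bracket: "full \<Longrightarrow> homog full M f \<Longrightarrow> homog full N g \<Longrightarrow> homog full (M + N) (free_bracket f g)"

text \<open>\<open>P\<close> carries a condition on the multidegrees through the decomposition.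
  Uniqueness of the components is not claimed; any nonzero summand will do.\<close>

inductive homog_sum :: "bool \<Rightarrow> ('v multiset \<Rightarrow> bool) \<Rightarrow> ('k::field_char_0, 'v) free_gpa \<Rightarrow> bool"
  for full P where
  zero: "homog_sum full P 0"
| add: "homog_sum full P f \<Longrightarrow> P N \<Longrightarrow> homog full N g \<Longrightarrow> homog_sum full P (f + g)"

lemma homog_sum_homog: "P N \<Longrightarrow> homog full N g \<Longrightarrow> homog_sum full P g"
  using homog_sum.add[OF homog_sum.zero, of P N full g] by simp

lemma homog_sum_add: "homog_sum full P f \<Longrightarrow> homog_sum full P g \<Longrightarrow> homog_sum full P (f + g)"
proof (induction rule: homog_sum.induct)
  case (add f N h)
  have "homog_sum full P (f + g + h)" by (rule homog_sum.add) (use add in auto)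
  then show ?case by (simp add: ac_simps)
qed simp

lemma homog_sum_scale: "homog_sum full P f \<Longrightarrow> homog_sum full P (free_scale c f)"
proof (induction rule: homog_sum.induct)
  case (add f N h)
  then show ?case using homog_sum.add[OF add.IH add.hyps(2) homog.scale[OF add.hyps(3)]]
    by (simp add: free.scale_right_distrib)
qed (simp add: homog_sum.zero)

lemma homog_sum_bilinear:
  fixes b :: "('k::field_char_0, 'v) free_gpa \<Rightarrow> ('k, 'v) free_gpa \<Rightarrow> ('k, 'v) free_gpa"
  assumes "homog_sum full P f" "homog_sum full Q g" "\<And>M N. P M \<Longrightarrow> Q N \<Longrightarrow> R (M + N)"
    and "\<And>x y z. b (x + y) z = b x z + b y z" "\<And>x y z. b x (y + z) = b x y + b x z"
    and "\<And>M N f g. homog full M f \<Longrightarrow> homog full N g \<Longrightarrow> homog full (M + N) (b f g)"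
  shows "homog_sum full R (b f g)"
proof -
  have zero: "b 0 x = 0" "b x 0 = 0" for x
    using assms(4)[of 0 0 x] assms(5)[of x 0 0] by simp_all
  show ?thesis
    using assms(1)
  proof (induction rule: homog_sum.induct)
    case zero
    show ?case by (simp add: \<open>b 0 g = 0\<close> homog_sum.zero)
  next
    case (add f M h)
    have "homog_sum full R (b h g)"
      using assms(2)
    proof (induction rule: homog_sum.induct)
      case zero
      show ?case by (simp add: \<open>b h 0 = 0\<close> homog_sum.zero)
    next
      case (add g' N k)
      show ?case unfolding assms(5)
        by (rule homog_sum.add[OF add.IH assms(3)[OF \<open>P M\<close> add.hyps(2)] assms(6)[OF \<open>homog full M h\<close> add.hyps(3)]])
    qed
    then show ?case using add.IH by (simp add: assms(4) homog_sum_add)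
  qed
qed

lemma homog_sum_mult:
  "homog_sum full P f \<Longrightarrow> homog_sum full Q g \<Longrightarrow> (\<And>M N. P M \<Longrightarrow> Q N \<Longrightarrow> R (M + N)) \<Longrightarrow>
    homog_sum full R (f * g)"
  by (rule homog_sum_bilinear[of full P f Q g R "(*)"]) (auto simp: algebra_simps intro: homog.mult)

lemma homog_sum_bracket:
  "full \<Longrightarrow> homog_sum full P f \<Longrightarrow> homog_sum full Q g \<Longrightarrow> (\<And>M N. P M \<Longrightarrow> Q N \<Longrightarrow> R (M + N)) \<Longrightarrow>
    homog_sum full R (free_bracket f g)"
  by (rule homog_sum_bilinear[of full P f Q g R free_bracket])
    (auto simp: free.bracket_add free.bracket_add_right intro: homog.bracket)

lemma homog_sum_all: "homog_sum True (\<lambda>_. True) f"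
proof (induction f rule: free_gpa_induct)
  case (gen v)
  show ?case by (rule homog_sum_homog[OF _ homog.gen]) auto
next
  case one
  show ?case by (rule homog_sum_homog[OF _ homog.one]) auto
next
  case (neg f)
  then show ?case using homog_sum_scale[of True _ f "-1"] by simp
next
  case (mult f g)
  then show ?case by (rule homog_sum_mult) simp
next
  case (bracket f g)
  then show ?case by (intro homog_sum_bracket) auto
qed (auto intro: homog_sum.zero homog_sum_add homog_sum_scale)

lemma customary_homog_sum: "customary V q \<Longrightarrow> homog_sum False (\<lambda>_. True) q"
proof (induction rule: customary.induct)
  case (scalar c)
  show ?case by (rule homog_sum_homog[OF _ homog.scale[OF homog.one]]) simp
next
  case (D_gen v)
  show ?case by (rule homog_sum_homog[OF _ homog.D_gen]) simp
next
  case (angle_gen u v)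
  show ?case by (rule homog_sum_homog[OF _ homog.angle_gen]) simp
next
  case (mult f g)
  then show ?case by (auto intro: homog_sum_mult)
qed (auto intro: homog_sum_add)

lemma homog_sum_components:
  assumes "homog_sum full P f"
  obtains A h where "finite A" "\<And>N. N \<in> A \<Longrightarrow> P N \<and> homog full N (h N)" "f = (\<Sum>N\<in>A. h N)"
proof -
  have "\<exists>A h. finite A \<and> (\<forall>N\<in>A. P N \<and> homog full N (h N)) \<and> f = (\<Sum>N\<in>A. h N)"
    using assms
  proof (induction rule: homog_sum.induct)
    case zero
    show ?case by (rule exI[of _ "{}"]) simp
  next
    case (add f M g)
    then obtain A h where A: "finite A" "\<forall>N\<in>A. P N \<and> homog full N (h N)" "f = (\<Sum>N\<in>A. h N)"
      by blast
    let ?h = "\<lambda>N. (if N \<in> A then h N else 0) + (if N = M then g else 0)"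
    have "(\<Sum>N\<in>insert M A. ?h N) = (\<Sum>N\<in>insert M A. if N \<in> A then h N else 0) + g"
      using A(1) by (simp add: sum.distrib)
    also have "(\<Sum>N\<in>insert M A. if N \<in> A then h N else 0) = f"
      unfolding A(3) using A(1) by (intro sum.mono_neutral_cong_right) auto
    finally have "f + g = (\<Sum>N\<in>insert M A. ?h N)" by simp
    moreover have "\<forall>N\<in>insert M A. P N \<and> homog full N (?h N)"
      using A add by (auto intro!: homog.add homog.zero)
    ultimately show ?case using A(1) by (intro exI[of _ "insert M A"] exI[of _ ?h]) simp
  qed
  then show thesis using that by blast
qed

context char0_gpa
begin
lemma homog_eval_cong:
  "homog full M f \<Longrightarrow> (\<And>v. v \<in># M \<Longrightarrow> a v = b v) \<Longrightarrow> eval a f = eval b f"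
  by (induction rule: homog.induct) simp_all
end

text \<open>Makes the degree in \<open>v\<close> visible as an eigenvalue of a substitution, which
  preserves identities.\<close>

lemma homog_rescale:
  "homog full M f \<Longrightarrow> free.eval (gen(v := free_scale c (gen v))) f = free_scale (c ^ count M v) f"
proof (induction rule: homog.induct)
  case (mult M f N g)
  then show ?case
    by (simp add: free.scale_mult[symmetric] free.mult_scale_right power_add mult.commute del: fun_upd_apply)
next
  case (bracket M f N g)
  then show ?case
    by (simp add: free.bracket_scale free.bracket_scale_right power_add mult.commute del: fun_upd_apply)
next
  case (angle_gen u w)
  then show ?case
    by (simp add: free.angle_scale_left free.angle_scale_right)
qed (auto simp: free.scale_right_distrib free.D_scale mult.commute)

lemma homog_rename:
  "homog full M f \<Longrightarrow> homog full (image_mset s M) (free.eval (\<lambda>v. gen (s v)) f)"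
  by (induction rule: homog.induct) (auto intro: homog.intros)

definition splits :: "'v \<Rightarrow> 'v \<Rightarrow> 'v multiset \<Rightarrow> 'v multiset \<Rightarrow> bool" where
  "splits v w M N \<longleftrightarrow> (\<forall>u. u \<noteq> v \<longrightarrow> u \<noteq> w \<longrightarrow> count N u = count M u) \<and> count N v + count N w = count M v"

lemma homog_split:
  assumes "homog full M f" "w \<notin># M" "v \<noteq> w"
  shows "homog_sum full (splits v w M) (free.eval (gen(v := gen v + gen w)) f)"
proof -
  have pair: "homog_sum full (splits v w {#u, u'#}) (free.angle (gen x) (gen x'))"
    if "x = u \<or> u = v \<and> x = w" "x' = u' \<or> u' = v \<and> x' = w" "u \<noteq> w" "u' \<noteq> w" for x x' u u'
    using that assms(3) by (intro homog_sum_homog[OF _ homog.angle_gen]) (auto simp: splits_def)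
  show ?thesis
    using assms(1,2)
  proof (induction rule: homog.induct)
    case (one)
    then show ?case by (auto intro!: homog_sum_homog homog.one simp: splits_def)
  next
    case (D_gen u)
    have "homog_sum full (splits v w {#u#}) (free.D (gen u))" if "u \<noteq> v"
      using that D_gen by (intro homog_sum_homog[OF _ homog.D_gen]) (auto simp: splits_def)
    moreover have "homog_sum full (splits v w {#v#}) (free.D (gen v) + free.D (gen w))"
      using assms(3) by (intro homog_sum_add homog_sum_homog[OF _ homog.D_gen]) (auto simp: splits_def)
    ultimately show ?case by (auto simp: free.D_add)
  next
    case (gen u)
    have "homog_sum full (splits v w {#u#}) (gen u)" if "u \<noteq> v"
      using that gen by (intro homog_sum_homog[OF _ homog.gen]) (auto simp: splits_def)
    moreover have "homog_sum full (splits v w {#v#}) (gen v + gen w)"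
      using assms(3) gen by (intro homog_sum_add homog_sum_homog[OF _ homog.gen]) (auto simp: splits_def)
    ultimately show ?case by auto
  next
    case (angle_gen u u')
    then show ?case
      by (cases "u = v"; cases "u' = v")
        (auto simp: free.angle_add_left free.angle_add_right intro!: homog_sum_add pair)
  next
    case (mult M f N g)
    have "homog_sum full (splits v w (M + N))
        (free.eval (gen(v := gen v + gen w)) f * free.eval (gen(v := gen v + gen w)) g)"
      by (rule homog_sum_mult[OF mult.IH(1) mult.IH(2)]) (use mult.prems in \<open>auto simp: splits_def\<close>)
    then show ?case by (simp del: fun_upd_apply)
  next
    case (bracket M f N g)
    have "homog_sum full (splits v w (M + N))
        (free_bracket (free.eval (gen(v := gen v + gen w)) f) (free.eval (gen(v := gen v + gen w)) g))"
      by (rule homog_sum_bracket[OF bracket.hyps(1) bracket.IH(1) bracket.IH(2)])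
        (use bracket.prems in \<open>auto simp: splits_def\<close>)
    then show ?case by (simp del: fun_upd_apply)
  qed (auto intro: homog_sum.zero homog_sum_add homog_sum_scale simp del: fun_upd_apply)
qed

section \<open>Separation of components and linearization of identities\<close>

context char0_gpa
begin

lemma two_power_eq_iff: "(2 ^ i :: 'k) = 2 ^ j \<longleftrightarrow> i = j"
proof -
  have "of_nat (2 ^ i) = (2 ^ i :: 'k)" "of_nat (2 ^ j) = (2 ^ j :: 'k)" by simp_all
  then have "(2 ^ i :: 'k) = 2 ^ j \<longleftrightarrow> (2 ^ i :: nat) = 2 ^ j" by (metis of_nat_eq_iff)
  also have "\<dots> \<longleftrightarrow> i = j" by simp
  finally show ?thesis .
qed

text \<open>A Vandermonde argument, one component at a time. Eliminating \<open>N\<close> leaves an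
  identity with fewer components, from which \<open>h M\<close> is obtained for some other
  \<open>M\<close>. Subtracting \<open>h M\<close> from the original sum leaves fewer components,
  \<open>N\<close> among them.\<close>

lemma identity_components:
  fixes h :: "'v multiset \<Rightarrow> ('k, 'v) free_gpa"
  assumes "finite A" "\<And>N. N \<in> A \<Longrightarrow> homog full N (h N)" "polynomial_identity (\<Sum>N\<in>A. h N)" "N \<in> A"
  shows "polynomial_identity (h N)"
  using assms
proof (induction "card A" arbitrary: A h N rule: less_induct)
  case less
  show ?case
  proof (cases "A = {N}")
    case True
    then show ?thesis using less.prems by simp
  next
    case False
    then obtain M where M: "M \<in> A" "M \<noteq> N" using less.prems(4) by blast
    then obtain v where v: "count M v \<noteq> count N v" by (meson multiset_eqI)
    \<comment> \<open>doubling \<open>v\<close> and subtracting a multiple of the original identity removes the component \<open>N\<close>\<close>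
    define e where "e K = (2 ^ count K v - 2 ^ count N v :: 'k)" for K :: "'v multiset"
    have "polynomial_identity (free.eval (gen(v := free_scale 2 (gen v))) (\<Sum>K\<in>A. h K)
        + free_scale (- (2 ^ count N v)) (\<Sum>K\<in>A. h K))"
      by (intro identity_add identity_scale identity_eval less.prems)
    also have "free.eval (gen(v := free_scale 2 (gen v))) (\<Sum>K\<in>A. h K)
        + free_scale (- (2 ^ count N v)) (\<Sum>K\<in>A. h K) = (\<Sum>K\<in>A. free_scale (e K) (h K))"
      by (simp add: free.eval_sum homog_rescale[OF less.prems(2)] free.scale_sum_right e_def
          free.scale_left_diff_distrib sum_subtractf sum_negf del: fun_upd_apply)
    also have "\<dots> = (\<Sum>K\<in>A - {N}. free_scale (e K) (h K))"
      using less.prems(1,4) by (intro sum.mono_neutral_right) (auto simp: e_def)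
    finally have "polynomial_identity (free_scale (e M) (h M))"
      using M less.prems(2)
      by (intro less.hyps[OF card_Diff1_less[OF less.prems(1,4)] finite_Diff[OF less.prems(1)],
            of "\<lambda>K. free_scale (e K) (h K)" M])
        (auto intro: homog.scale)
    then have "polynomial_identity (free_scale (inverse (e M)) (free_scale (e M) (h M)))"
      by (rule identity_scale)
    moreover have "e M \<noteq> 0" using v by (simp add: e_def two_power_eq_iff)
    ultimately have hM: "polynomial_identity (h M)" by simp
    have "polynomial_identity ((\<Sum>K\<in>A. h K) + free_scale (- 1) (h M))"
      by (intro identity_add identity_scale hM less.prems)
    also have "(\<Sum>K\<in>A. h K) + free_scale (- 1) (h M) = (\<Sum>K\<in>A - {M}. h K)"
      using less.prems(1) M(1) by (simp add: sum.remove)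
    finally show ?thesis
      using M less.prems(2,4)
      by (intro less.hyps[OF card_Diff1_less[OF less.prems(1) M(1)] finite_Diff[OF less.prems(1)], of h N]) auto
  qed
qed

text \<open>Substitute \<open>v + w\<close> for \<open>v\<close> and separate components. Some
  component in which both letters occur must be nonzero, or else restitution would contradict
  \<open>f \<noteq> 0\<close>.\<close>

lemma linearize_step:
  fixes f :: "('k, 'v) free_gpa"
  assumes "homog full M f" "polynomial_identity f" "f \<noteq> 0" "w \<notin># M" "2 \<le> count M v"
  shows "\<exists>N g. splits v w M N \<and> 0 < count N w \<and> 0 < count N v \<and> homog full N g
    \<and> polynomial_identity g \<and> g \<noteq> 0"
proof (rule ccontr)
  assume contr: "\<not> ?thesis"
  have vw: "v \<noteq> w" using assms(4,5) by (metis count_inI not_numeral_le_zero)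
  define c where "c = count M v"
  obtain A h where A: "finite A" "\<And>N. N \<in> A \<Longrightarrow> splits v w M N \<and> homog full N (h N)"
    and f: "free.eval (gen(v := gen v + gen w)) f = (\<Sum>N\<in>A. h N)"
    using homog_sum_components[OF homog_split[OF assms(1,4) vw]] by metis
  have sum_id: "polynomial_identity (\<Sum>N\<in>A. h N)"
    using identity_eval[OF assms(2)] unfolding f[symmetric] by blast
  have zero: "h N = 0" if "N \<in> A" "count N w \<noteq> 0" "count N w \<noteq> c" for N
  proof (rule ccontr)
    assume "h N \<noteq> 0"
    moreover have "polynomial_identity (h N)"
      by (rule identity_components[OF A(1) _ sum_id that(1)]) (use A(2) in blast)
    moreover have "0 < count N v" "0 < count N w"
      using A(2)[OF that(1)] that(2,3) unfolding splits_def c_def by linarith+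
    ultimately show False using contr A(2)[OF that(1)] by blast
  qed
  \<comment> \<open>If only the extreme degrees \<open>0\<close> and \<open>c\<close> in \<open>w\<close> occurred, the values of \<open>\<rho>\<close> at \<open>0\<close>, \<open>1\<close> and \<open>- 1\<close>
    would be incompatible.\<close>
  define \<rho> where "\<rho> s = free.eval (gen(w := free_scale s (gen v)))" for s :: 'k
  have scale_step: "\<rho> s (h N) = free_scale (s ^ count N w) (\<rho> 1 (h N))" if "N \<in> A" for s N
  proof -
    have "\<rho> s (h N) = \<rho> 1 (free.eval (gen(w := free_scale s (gen w))) (h N))"
      unfolding \<rho>_def free.eval_eval
      by (rule arg_cong[of _ _ "\<lambda>s. free.eval s (h N)"]) (use vw in auto)
    also have "\<dots> = free_scale (s ^ count N w) (\<rho> 1 (h N))"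
      unfolding homog_rescale[OF conjunct2[OF A(2)[OF that]]] \<rho>_def free.eval_simps ..
    finally show ?thesis .
  qed
  define a b where "a = (\<Sum>N\<in>{N\<in>A. count N w = 0}. \<rho> 1 (h N))"
    and "b = (\<Sum>N\<in>{N\<in>A. count N w = c}. \<rho> 1 (h N))"
  \<comment> \<open>Substituting \<open>s v\<close> for \<open>w\<close> after \<open>v + w\<close>
    for \<open>v\<close> amounts to multiplying \<open>v\<close> by \<open>1 + s\<close>, because
    \<open>w\<close> does not occur in \<open>f\<close>.\<close>
  have restitution: "free_scale ((1 + s) ^ c) f = (\<Sum>N\<in>A. \<rho> s (h N))" for s
  proof -
    have "(\<Sum>N\<in>A. \<rho> s (h N)) = \<rho> s (free.eval (gen(v := gen v + gen w)) f)"
      unfolding f \<rho>_def free.eval_sum ..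
    also have "\<dots> = free.eval (gen(v := free_scale (1 + s) (gen v))) f"
      unfolding \<rho>_def free.eval_eval
      by (rule free.homog_eval_cong[OF assms(1)])
        (use vw assms(4) in \<open>auto simp: free.scale_left_distrib\<close>)
    finally show ?thesis using homog_rescale[OF assms(1), of v "1 + s"] c_def by simp
  qed
  have ab: "free_scale ((1 + s) ^ c) f = a + free_scale (s ^ c) b" for s
  proof -
    have "(\<Sum>N\<in>A. \<rho> s (h N)) = (\<Sum>N\<in>A. (if count N w = 0 then \<rho> 1 (h N) else 0)
        + (if count N w = c then free_scale (s ^ c) (\<rho> 1 (h N)) else 0))"
      using assms(5) zero by (intro sum.cong) (auto simp: scale_step[of _ s] c_def, auto simp: \<rho>_def)
    then show ?thesis
      using A(1) by (simp add: restitution a_def b_def sum.distrib sum.inter_filter free.scale_sum_right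
          if_distrib[where f = "free_scale (s ^ c)"] cong: if_cong)
  qed
  have c: "c \<ge> 2" using assms(5) by (simp add: c_def)
  have a: "a = f" using ab[of 0] c by simp
  have b: "b = free_scale (2 ^ c - 1) f" using ab[of 1] by (simp add: a free.scale_left_diff_distrib)
  \<comment> \<open>At \<open>s = - 1\<close> the left side of \<open>ab\<close> vanishes. The
    scalar on \<open>f\<close> is \<open>2 ^ c\<close> for even \<open>c\<close> and
    \<open>2 - 2 ^ c\<close> for odd \<open>c\<close>, nonzero since
    \<open>c \<ge> 2\<close>.\<close>
  have "free_scale (1 + (- 1) ^ c * (2 ^ c - 1)) f = 0"
    using ab[of "- 1"] c by (simp add: a b free.scale_left_distrib power_0_left)
  moreover have "(1 + (- 1) ^ c * (2 ^ c - 1) :: 'k) \<noteq> 0"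
  proof (cases "even c")
    case False
    have "(2 :: 'k) - 2 ^ c \<noteq> 0" using two_power_eq_iff[of 1 c] c by auto
    then show ?thesis using False by simp
  qed simp
  ultimately show False using assms(3) by simp
qed

text \<open>The measure counts repeated occurrences of variables. A step keeps the total degree and
  introduces one new letter, so the measure drops. The type \<open>nat\<close> always provides a
  fresh letter, and \<open>card S = size M\<close> is recorded to keep track of the degree.\<close>

lemma linearize:
  fixes f :: "('k, nat) free_gpa"
  assumes "homog full M f" "polynomial_identity f" "f \<noteq> 0"
  shows "\<exists>S (g :: ('k, nat) free_gpa). finite S \<and> card S = size M \<and> homog full (mset_set S) g \<and> polynomial_identity g \<and> g \<noteq> 0"
  using assms
proof (induction "size M - card (set_mset M)" arbitrary: M f rule: less_induct)
  case less
  show ?case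
  proof (cases "\<exists>v. 2 \<le> count M v")
    case True
    then obtain v where v: "2 \<le> count M v" by blast
    obtain w where w: "w \<notin># M" using ex_new_if_finite[OF infinite_UNIV_nat finite_set_mset] by blast
    obtain N g where N: "splits v w M N" "0 < count N w" "0 < count N v" "homog full N g"
      "polynomial_identity g" "g \<noteq> 0"
      using linearize_step[OF less.prems w v] by blast
    have vw: "v \<noteq> w" using w v by (metis count_inI not_numeral_le_zero)
    have "u \<in># N \<longleftrightarrow> u \<in> insert w (set_mset M)" for u
    proof -
      have "count M v > 0" using v by linarith
      then show ?thesis
        using N(1-3) unfolding splits_def count_greater_zero_iff[symmetric] insert_iff
        by (cases "u = v"; cases "u = w") auto
    qed
    then have "set_mset N = insert w (set_mset M)" by blast
    then have card: "card (set_mset N) = Suc (card (set_mset M))" using w by simp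
    have size: "size N = size M"
    proof -
      \<comment> \<open>\<open>N\<close> arises from \<open>M\<close> by turning
        \<open>count N w\<close> copies of \<open>v\<close> into \<open>w\<close>.\<close>
      have "N + replicate_mset (count N w) v = M + replicate_mset (count N w) w"
        using N(1) w vw by (intro multiset_eqI) (auto simp: splits_def not_in_iff)
      then have "size (N + replicate_mset (count N w) v) = size (M + replicate_mset (count N w) w)"
        by simp
      then show ?thesis by simp
    qed
    have "(\<Sum>u\<in>set_mset N. 1) \<le> (\<Sum>u\<in>set_mset N. count N u)" by (rule sum_mono) simp
    then have "card (set_mset N) \<le> size N" by (simp add: size_multiset_overloaded_eq)
    then have "size N - card (set_mset N) < size M - card (set_mset M)" using card size by linarith
    from less.hyps[OF this N(4-6)] show ?thesis by (simp add: size)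
  next
    case False
    have le: "count M v \<le> 1" for v
    proof -
      have "count M v < 2" using False by (simp add: not_le)
      then show ?thesis by simp
    qed
    have M: "mset_set (set_mset M) = M"
    proof (rule multiset_eqI)
      fix v show "count (mset_set (set_mset M)) v = count M v"
        using le[of v] by (cases "v \<in># M") (auto simp: count_mset_set not_in_iff le_antisym)
    qed
    have "card (set_mset M) = size M"
      using size_mset_set[of "set_mset M"] unfolding M by simp
    moreover have "homog full (mset_set (set_mset M)) f" unfolding M by (rule less.prems)
    ultimately show ?thesis using less.prems(2,3) finite_set_mset by blast
  qed
qed

end

text \<open>Multilinearity makes the variables of two factors disjoint, as the rules of
  \<open>symbol\<close> demand. A bracket is its angle plus two products of order one less, which
  are raised by \<open>bounded_order_Suc\<close>.\<close>

lemma homog_bounded_order: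
  assumes "homog full M f" "\<And>v. count M v \<le> 1"
  shows "\<exists>d. bounded_order (set_mset M) d f"
  using assms
proof (induction rule: homog.induct)
  case (zero M)
  show ?case by (simp add: bounded_order_zero)
next
  case (add M f g)
  then obtain d e where "bounded_order (set_mset M) d f" "bounded_order (set_mset M) e g" by blast
  then have "bounded_order (set_mset M) (max d e) f" "bounded_order (set_mset M) (max d e) g"
    using bounded_order_mono[OF _ max.cobounded1] bounded_order_mono[OF _ max.cobounded2] by blast+
  then show ?case by (intro exI, rule bounded_order_add)
next
  case (scale M f c)
  then show ?case using bounded_order_scale by blast
next
  case one
  then show ?case unfolding bounded_order_def using symbol.one by auto
next
  case (D_gen v)
  then show ?case using bounded_order_letter[of v 1] by (auto simp: letter_def)
next
  case (angle_gen u v)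
  have "u \<noteq> v" using angle_gen[of u] by auto
  then have "bounded_order ({u} \<union> {v}) (Suc (Suc (0 + 0))) (free.angle (gen u) (gen v))"
    using bounded_order_letter[of u 0] bounded_order_letter[of v 0]
    by (intro bounded_order_angle) (auto simp: letter_def)
  then show ?case by (auto simp: insert_commute)
next
  case (mult M f N g)
  have "count M v \<le> 1 \<and> count N v \<le> 1" "\<not> (v \<in># M \<and> v \<in># N)" for v
    using mult.prems[of v] by (auto simp flip: count_greater_zero_iff)
  note * = this
  then have disj: "set_mset M \<inter> set_mset N = {}" by blast
  obtain d e where "bounded_order (set_mset M) d f" "bounded_order (set_mset N) e g"
    using mult.IH * by blast
  from bounded_order_mult[OF this disj] show ?case by auto
next
  case (gen v)
  then show ?case using bounded_order_letter[of v 0] by (auto simp: letter_def)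
next
  case (bracket M f N g)
  have *: "count M v \<le> 1 \<and> count N v \<le> 1" "\<not> (v \<in># M \<and> v \<in># N)" for v
    using bracket.prems[of v] by (auto simp flip: count_greater_zero_iff)
  then have disj: "set_mset M \<inter> set_mset N = {}" by blast
  obtain d e where de: "bounded_order (set_mset M) d f" "bounded_order (set_mset N) e g"
    using bracket.IH * by blast
  let ?B = "bounded_order (set_mset M \<union> set_mset N) (Suc (Suc (d + e)))"
  have "?B (free.angle f g)" by (rule bounded_order_angle[OF de disj])
  moreover have "?B (free.D f * g)"
    using bounded_order_mult[OF bounded_order_D[OF de(1)] de(2) disj] by (auto intro: bounded_order_Suc)
  moreover have "?B (free_scale (- 1) (f * free.D g))"
    using bounded_order_mult[OF de(1) bounded_order_D[OF de(2)] disj]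
    by (intro bounded_order_scale) (auto intro: bounded_order_Suc)
  ultimately have "?B (free.angle f g + (free.D f * g + free_scale (- 1) (f * free.D g)))"
    by (intro bounded_order_add)
  then show ?case by (auto simp: free.bracket_angle)
qed

section \<open>Reduction to countably many variables\<close>

context char0_gpa
begin

lemma eval_finite_support:
  "\<exists>V. finite V \<and> (\<forall>a b. (\<forall>v\<in>V. a v = b v) \<longrightarrow> eval a f = eval b f)"
    (is "?supp f")
proof -
  have binary: "?supp h" if "?supp f" "?supp g" "\<And>a. eval a h = F (eval a f) (eval a g)" for f g h F
  proof -
    obtain V W where V: "finite V" "\<And>a b. (\<forall>v\<in>V. a v = b v) \<Longrightarrow> eval a f = eval b f"
      and W: "finite W" "\<And>a b. (\<forall>v\<in>W. a v = b v) \<Longrightarrow> eval a g = eval b g"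
      using \<open>?supp f\<close> \<open>?supp g\<close> by blast
    show ?thesis
    proof (intro exI[of _ "V \<union> W"] conjI allI impI)
      show "finite (V \<union> W)" using V(1) W(1) by simp
      fix a b :: "'b \<Rightarrow> 'a"
      assume ab: "\<forall>v\<in>V \<union> W. a v = b v"
      have "eval a f = eval b f" by (rule V(2)) (use ab in blast)
      moreover have "eval a g = eval b g" by (rule W(2)) (use ab in blast)
      ultimately show "eval a h = eval b h" by (simp only: that(3))
    qed
  qed
  show ?thesis
  proof (induction f rule: free_gpa_induct)
    case (gen v)
    show ?case by (rule exI[of _ "{v}"]) simp
  next
    case (add f g)
    then show ?case by (rule binary) (rule eval_simps)
  next
    case (mult f g)
    then show ?case by (rule binary) (rule eval_simps)
  next
    case (bracket f g)
    then show ?case by (rule binary) (rule eval_simps)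
  next
    case (neg f)
    then show ?case by simp
  next
    case (scale c f)
    show ?case by (rule binary[OF scale scale]) (rule eval_simps)
  qed auto
qed

text \<open>The generators may form any type, but a single element depends on finitely many of them.
  Renaming these injectively by natural numbers can be undone, so the result is nonzero.\<close>

lemma identity_in_nat_variables:
  fixes g :: "('k, 'v) free_gpa"
  assumes "polynomial_identity g" "g \<noteq> 0"
  shows "\<exists>f :: ('k, nat) free_gpa. polynomial_identity f \<and> f \<noteq> 0"
proof -
  obtain V where V: "finite V"
    "\<And>a b :: 'v \<Rightarrow> ('k, 'v) free_gpa. (\<forall>v\<in>V. a v = b v) \<Longrightarrow> free.eval a g = free.eval b g"
    using free.eval_finite_support[of g] by blast
  obtain s :: "'v \<Rightarrow> nat" where s: "inj_on s V"
    using finite_imp_inj_to_nat_seg[OF V(1)] by blast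
  let ?f = "free.eval (\<lambda>v. gen (s v)) g :: ('k, nat) free_gpa"
  have "free.eval (\<lambda>n. gen (inv_into V s n)) ?f = free.eval (\<lambda>v. gen (inv_into V s (s v))) g"
    by (simp add: free.eval_eval)
  also have "\<dots> = free.eval gen g" by (rule V(2)) (use s in simp)
  finally have "free.eval (\<lambda>n. gen (inv_into V s n)) ?f = g" by (simp add: eval_gen)
  then have "?f \<noteq> 0" using assms(2) by auto
  then show ?thesis using identity_eval[OF assms(1)] by blast
qed

end

section \<open>Multilinear customary elements as combinations of monomials\<close>

lemma span_mult:
  fixes f g :: "('k::field_char_0, 'v) free_gpa"
  assumes "f \<in> free.span A" "g \<in> free.span B" "\<And>a b. a \<in> A \<Longrightarrow> b \<in> B \<Longrightarrow> a * b \<in> C"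
  shows "f * g \<in> free.span C"
  using assms(1)
proof (induction rule: free.span_induct_alt)
  case base
  show ?case by (simp add: free.span_zero)
next
  case (step c a f)
  have "a * g \<in> free.span C"
    using assms(2)
  proof (induction rule: free.span_induct_alt)
    case base
    show ?case by (simp add: free.span_zero)
  next
    case (step d b h)
    then show ?case
      using assms(3)[OF \<open>a \<in> A\<close> step(1)]
      by (simp add: distrib_left free.mult_scale_right free.span_add free.span_scale free.span_base)
  qed
  then show ?case using step
    by (simp add: distrib_right free.span_add free.span_scale flip: free.scale_mult)
qed

definition flatten :: "('v \<times> 'v) list \<Rightarrow> 'v list" where
  "flatten ps = concat (map (\<lambda>(a, b). [a, b]) ps)"

lemma flatten_simps [simp]:
  "flatten [] = []" "flatten ((a, b) # ps) = a # b # flatten ps" "flatten (ps @ qs) = flatten ps @ flatten qs"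
  by (simp_all add: flatten_def)

lemma length_flatten [simp]: "length (flatten ps) = 2 * length ps"
  by (induction ps) auto

lemma nth_flatten:
  "k < length ps \<Longrightarrow> flatten ps ! (2 * k) = fst (ps ! k) \<and> flatten ps ! Suc (2 * k) = snd (ps ! k)"
proof (induction ps arbitrary: k)
  case (Cons p ps)
  then show ?case by (cases k; cases p) auto
qed simp

definition pair_monomial :: "('v \<times> 'v) list \<Rightarrow> 'v list \<Rightarrow> ('k::field_char_0, 'v) free_gpa" where
  "pair_monomial ps ds = (\<Prod>p\<leftarrow>ps. free.angle (gen (fst p)) (gen (snd p))) * (\<Prod>d\<leftarrow>ds. free.D (gen d))"

lemma homog_pair_monomials:
  fixes f :: "('k::field_char_0, 'v) free_gpa"
  assumes "homog full M f" "\<not> full"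
  shows "f \<in> free.span {pair_monomial ps ds | ps ds. mset (flatten ps @ ds) = M}"
  using assms
proof (induction rule: homog.induct)
  case (one)
  have "(1 :: ('k, 'v) free_gpa) = pair_monomial [] []" by (simp add: pair_monomial_def)
  then show ?case by (intro free.span_base) force
next
  case (D_gen v)
  have "free.D (gen v) = pair_monomial [] [v]" by (simp add: pair_monomial_def)
  then show ?case by (intro free.span_base) force
next
  case (angle_gen u v)
  have "free.angle (gen u) (gen v) = pair_monomial [(u, v)] []" by (simp add: pair_monomial_def)
  then show ?case by (intro free.span_base) force
next
  case (mult M f N g)
  show ?case
  proof (rule span_mult[OF mult.IH(1)[OF mult.prems] mult.IH(2)[OF mult.prems]])
    fix a b :: "('k, 'v) free_gpa"
    assume "a \<in> {pair_monomial ps ds | ps ds. mset (flatten ps @ ds) = M}"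
      "b \<in> {pair_monomial ps ds | ps ds. mset (flatten ps @ ds) = N}"
    then obtain ps ds qs es where a: "a = pair_monomial ps ds" "mset (flatten ps @ ds) = M"
      and b: "b = pair_monomial qs es" "mset (flatten qs @ es) = N" by blast
    have "a * b = pair_monomial (ps @ qs) (ds @ es)"
      by (simp add: a b pair_monomial_def ac_simps)
    moreover have "mset (flatten (ps @ qs) @ (ds @ es)) = M + N"
      using a b by (auto simp: ac_simps)
    ultimately show "a * b \<in> {pair_monomial ps ds | ps ds. mset (flatten ps @ ds) = M + N}" by blast
  qed
qed (auto intro: free.span_zero free.span_add free.span_scale)

definition customary_monomial :: "nat \<Rightarrow> (nat \<Rightarrow> nat) \<Rightarrow> nat \<Rightarrow> ('k::field_char_0, nat) free_gpa" where
  "customary_monomial m \<sigma> i = (\<Prod>j = 1..i. free.angle (gen (\<sigma> (2 * j - 1))) (gen (\<sigma> (2 * j)))) *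
     (\<Prod>j = 2 * i + 1..m. free.D (gen (\<sigma> j)))"

lemma prod_list_nth: "(\<Prod>x\<leftarrow>xs. f x) = (\<Prod>k<length xs. f (xs ! k) :: 'a::comm_monoid_mult)"
  by (induction xs) (simp_all add: prod.lessThan_Suc_shift del: prod.lessThan_Suc)

text \<open>A word in which each of the letters 1 to \<open>m\<close> occurs once is a permutation;
  the pairs occupy its first positions.\<close>

lemma pair_monomial_customary:
  assumes "mset (flatten ps @ ds) = mset_set {1..m}"
  shows "\<exists>\<sigma> i. \<sigma> permutes {1..m} \<and> i \<le> m div 2 \<and>
    (pair_monomial ps ds :: ('k::field_char_0, nat) free_gpa) = customary_monomial m \<sigma> i"
proof -
  let ?xs = "flatten ps @ ds"
  \<comment> \<open>Lists are indexed from 0 and permutations of \<open>{1..m}\<close> from 1;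
    outside this set \<open>permutes\<close> demands the identity.\<close>
  define \<sigma> where "\<sigma> j = (if j \<in> {1..m} then ?xs ! (j - 1) else j)" for j
  have len: "length ?xs = m" using arg_cong[OF assms, of size] by simp
  have set: "set ?xs = {1..m}" using arg_cong[OF assms, of set_mset] by simp
  have dist: "distinct ?xs" using set len by (intro card_distinct) simp
  have "bij_betw ((!) ?xs) {..<m} {1..m}" using bij_betw_nth[OF dist] len set by simp
  moreover have "bij_betw (\<lambda>j. j - 1) {1..m} {..<m}"
    by (rule bij_betwI[of _ _ _ Suc]) auto
  ultimately have "bij_betw ((!) ?xs \<circ> (\<lambda>j. j - 1)) {1..m} {1..m}" by (rule bij_betw_trans[rotated])
  then have "bij_betw \<sigma> {1..m} {1..m}" by (subst bij_betw_cong[of _ \<sigma>]) (auto simp: \<sigma>_def)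
  then have perm: "\<sigma> permutes {1..m}" by (rule bij_imp_permutes) (auto simp: \<sigma>_def)
  have le: "2 * length ps \<le> m" using len by simp
  have "(\<Prod>j = 1..length ps. free.angle (gen (\<sigma> (2 * j - 1))) (gen (\<sigma> (2 * j))))
     = (\<Prod>k<length ps. free.angle (gen (fst (ps ! k))) (gen (snd (ps ! k))) :: ('k, nat) free_gpa)"
  proof (rule prod.reindex_bij_witness[of _ Suc "\<lambda>j. j - 1"])
    fix j assume "j \<in> {1..length ps}"
    then obtain k where k: "j = Suc k" "k < length ps" by (cases j) auto
    have "\<sigma> (2 * j - 1) = fst (ps ! k)" "\<sigma> (2 * j) = snd (ps ! k)"
      using k le nth_flatten[OF k(2)] by (auto simp: \<sigma>_def nth_append)
    then show "free.angle (gen (fst (ps ! (j - 1)))) (gen (snd (ps ! (j - 1))))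
      = (free.angle (gen (\<sigma> (2 * j - 1))) (gen (\<sigma> (2 * j))) :: ('k, nat) free_gpa)"
      using k by simp
  qed auto
  moreover have "(\<Prod>j = 2 * length ps + 1..m. free.D (gen (\<sigma> j)))
     = (\<Prod>k<length ds. free.D (gen (ds ! k)) :: ('k, nat) free_gpa)"
  proof (rule prod.reindex_bij_witness[of _ "\<lambda>k. k + 2 * length ps + 1" "\<lambda>j. j - (2 * length ps + 1)"])
    fix j assume "j \<in> {2 * length ps + 1..m}"
    then show "free.D (gen (ds ! (j - (2 * length ps + 1)))) = (free.D (gen (\<sigma> j)) :: ('k, nat) free_gpa)"
      by (auto simp: \<sigma>_def nth_append)
  qed (use len in auto)
  ultimately have "(pair_monomial ps ds :: ('k, nat) free_gpa) = customary_monomial m \<sigma> (length ps)"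
    by (simp add: pair_monomial_def customary_monomial_def prod_list_nth)
  then show ?thesis using perm le by (intro exI[of _ \<sigma>] exI[of _ "length ps"]) auto
qed

text \<open>Different pairs of a permutation and a number may give the same monomial. Each monomial
  of the span is booked at one pair chosen for it, so the coefficients are not unique.\<close>

lemma homog_customary:
  fixes g :: "('k::field_char_0, nat) free_gpa"
  assumes "homog False (mset_set {1..m}) g"
  shows "\<exists>c. g = (\<Sum>i = 0..m div 2. \<Sum>\<sigma> | \<sigma> permutes {1..m}. free_scale (c \<sigma> i) (customary_monomial m \<sigma> i))"
proof -
  have "g \<in> free.span {pair_monomial ps ds | ps ds. mset (flatten ps @ ds) = mset_set {1..m}}"
    using homog_pair_monomials[OF assms] by simp
  then show ?thesis
  proof (induction rule: free.span_induct_alt)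
    case base
    show ?case by (rule exI[of _ "\<lambda>_ _. 0"]) simp
  next
    case (step a x g)
    then obtain c where c: "g = (\<Sum>i = 0..m div 2. \<Sum>\<sigma> | \<sigma> permutes {1..m}. free_scale (c \<sigma> i) (customary_monomial m \<sigma> i))"
      by blast
    obtain \<tau> k where x: "\<tau> permutes {1..m}" "k \<le> m div 2" "x = customary_monomial m \<tau> k"
      using step(1) pair_monomial_customary by blast
    have "(\<Sum>i = 0..m div 2. \<Sum>\<sigma> | \<sigma> permutes {1..m}.
        free_scale (if \<sigma> = \<tau> \<and> i = k then a else 0) (customary_monomial m \<sigma> i))
      = (\<Sum>i = 0..m div 2. if i = k then (\<Sum>\<sigma> | \<sigma> permutes {1..m}. if \<sigma> = \<tau> then free_scale a x else 0) else 0)"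
      using x by (intro sum.cong HOL.refl) (auto intro!: sum.cong)
    also have "\<dots> = free_scale a x"
      using x finite_permutations[of "{1..m}"] by (simp add: sum.delta)
    finally have "free_scale a x + g = (\<Sum>i = 0..m div 2. \<Sum>\<sigma> | \<sigma> permutes {1..m}.
      free_scale ((if \<sigma> = \<tau> \<and> i = k then a else 0) + c \<sigma> i) (customary_monomial m \<sigma> i))"
      by (simp only: c free.scale_left_distrib sum.distrib)
    then show ?case
      by (rule exI[of _ "\<lambda>\<sigma> i. (if \<sigma> = \<tau> \<and> i = k then a else 0) + c \<sigma> i"])
  qed
qed

section \<open>From an arbitrary identity to a customary multilinear one\<close>

context char0_gpa
begin

text \<open>The symbol of a multilinear element need not be multilinear, because every
  \<open>D\<close> and \<open>angle\<close> contributes a whole \<open>vsum\<close>. Hence a second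
  separation and linearization, now with \<open>full = False\<close> so that the result stays
  customary.\<close>

lemma customary_identity:
  fixes f :: "('k, nat) free_gpa"
  assumes "polynomial_identity f" "f \<noteq> 0"
  shows "\<exists>m\<ge>1. \<exists>g :: ('k, nat) free_gpa. homog False (mset_set {1..m}) g \<and> g \<noteq> 0 \<and> polynomial_identity g"
proof -
  have nonzero_component: "\<exists>N (h :: ('k, nat) free_gpa). P N \<and> homog full N h \<and> polynomial_identity h \<and> h \<noteq> 0"
    if f: "homog_sum full P f" "polynomial_identity f" "f \<noteq> 0" for full P and f :: "('k, nat) free_gpa"
  proof -
    obtain A h where A: "finite A" "\<And>N. N \<in> A \<Longrightarrow> P N \<and> homog full N (h N)" "f = (\<Sum>N\<in>A. h N)"
      using homog_sum_components[OF f(1)] by metis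
    obtain N where N: "N \<in> A" "h N \<noteq> 0" using f(3) unfolding A(3) by (meson sum.neutral)
    have "polynomial_identity (h N)"
      by (rule identity_components[OF A(1) _ _ N(1)]) (use A(2) f(2) in \<open>auto simp flip: A(3)\<close>)
    then show ?thesis using A(2)[OF N(1)] N(2) by blast
  qed
  obtain M and h :: "('k, nat) free_gpa" where h: "homog True M h" "polynomial_identity h" "h \<noteq> 0"
    using nonzero_component[OF homog_sum_all assms] by blast
  obtain S and f' :: "('k, nat) free_gpa" where f': "finite S" "homog True (mset_set S) f'" "polynomial_identity f'" "f' \<noteq> 0"
    using linearize[OF h] by blast
  obtain d where "bounded_order (set_mset (mset_set S)) d f'"
    using homog_bounded_order[OF f'(2)] by (metis count_mset_set'(1) le_numeral_extra(3,4) zero_le_one count_mset_set(1,2,3))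
  then have "bounded_order S d f'" using f'(1) by simp
  from bounded_order_nonnull_symbol[OF this f'(4)] obtain d q
    where q: "symbol S d f' q" "\<not> null q" by blast
  obtain w l where w: "antisymmetric w" and wl: "model_eval w l q \<noteq> 0"
    using q(2) unfolding null_def by blast
  \<comment> \<open>the factor \<open>D v\<close> makes the degree positive\<close>
  obtain v where v: "v \<notin> S" using ex_new_if_finite[OF infinite_UNIV_nat f'(1)] by blast
  \<comment> \<open>As \<open>v\<close> is fresh, \<open>l v\<close> can be set to 1 without
    changing the value of \<open>q\<close>; then the product with \<open>D v\<close> still has a
    nonzero value.\<close>
  have "model_eval w (l(v := 1)) q = model_eval w l q"
    by (rule model_eval_cong[OF symbol_customary[OF q(1)] w w]) (use v in auto)
  then have "model_eval w (l(v := 1)) (free.D (gen v) * q) \<noteq> 0"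
    using wl by (simp add: model_simps[OF w])
  then have nz: "free.D (gen v) * q \<noteq> 0" using model_simps(1)[OF w] by metis
  have "homog_sum False (\<lambda>M. size M \<ge> 1) (free.D (gen v) * q)"
    by (rule homog_sum_mult[OF homog_sum_homog[OF _ homog.D_gen] customary_homog_sum[OF symbol_customary[OF q(1)]],
        where P = "\<lambda>M. size M \<ge> 1"]) auto
  from nonzero_component[OF this identity_mult[OF identity_symbol[OF f'(3) q(1)]] nz]
  obtain N and k :: "('k, nat) free_gpa" where k: "size N \<ge> 1" "homog False N k" "polynomial_identity k" "k \<noteq> 0" by blast
  obtain T and g :: "('k, nat) free_gpa" where g: "finite T" "card T = size N" "homog False (mset_set T) g"
    "polynomial_identity g" "g \<noteq> 0"
    using linearize[OF k(2-4)] by blast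
  let ?m = "card T"
  obtain s where s: "bij_betw s T {1..?m}"
    using g(1) by (metis card_atLeastAtMost diff_Suc_1 finite_atLeastAtMost finite_same_card_bij)
  let ?g = "free.eval (\<lambda>v. gen (s v)) g"
  have inj: "inj_on s T" using s by (rule bij_betw_imp_inj_on)
  have "image_mset s (mset_set T) = mset_set {1..?m}"
    using image_mset_mset_set[OF inj] bij_betw_imp_surj_on[OF s] by simp
  then have "homog False (mset_set {1..?m}) ?g" using homog_rename[OF g(3), of s] by simp
  moreover have "?g \<noteq> 0"
  proof -
    have "free.eval (\<lambda>n. gen (inv_into T s n)) ?g = free.eval (\<lambda>v. gen (inv_into T s (s v))) g"
      by (simp add: free.eval_eval)
    also have "\<dots> = free.eval gen g"
      by (rule free.homog_eval_cong[OF g(3)]) (use inj g(1) in auto)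
    finally show ?thesis using g(5) by (auto simp: eval_gen)
  qed
  moreover have "polynomial_identity ?g" by (rule identity_eval[OF g(4)])
  ultimately show ?thesis using g(2) k(1) by (intro exI[of _ ?m]) auto
qed

end

theorem theorem13:
  fixes scale :: "'k::field_char_0 \<Rightarrow> 'a::{comm_ring,comm_monoid_mult} \<Rightarrow> 'a"
    and bracket :: "'a \<Rightarrow> 'a \<Rightarrow> 'a"
    and g0 :: "('k, 'v) free_gpa"
  assumes "unital_gpa scale bracket"
    and "unital_gpa.polynomial_identity scale bracket g0"
    and "g0 \<noteq> 0"
  shows "\<exists>m\<ge>1. \<exists>(c :: (nat \<Rightarrow> nat) \<Rightarrow> nat \<Rightarrow> 'k) (g :: ('k, nat) free_gpa).
    g = (\<Sum>i = 0..m div 2. \<Sum>\<sigma> | \<sigma> permutes {1..m}.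
           free_scale (c \<sigma> i)
             ((\<Prod>j = 1..i. free.angle (gen (\<sigma> (2 * j - 1))) (gen (\<sigma> (2 * j)))) *
              (\<Prod>j = 2 * i + 1..m. free.D (gen (\<sigma> j))))) \<and>
    g \<noteq> 0 \<and>
    unital_gpa.polynomial_identity scale bracket g"
proof -
  interpret unital_gpa scale bracket by fact
  interpret char0_gpa scale bracket ..
  obtain f :: "('k, nat) free_gpa" where f: "polynomial_identity f" "f \<noteq> 0"
    using identity_in_nat_variables[OF assms(2,3)] by blast
  obtain m g where g: "m \<ge> 1" "homog False (mset_set {1..m}) (g :: ('k, nat) free_gpa)" "g \<noteq> 0" "polynomial_identity g"
    using customary_identity[OF f] by blast
  from homog_customary[OF g(2)] g(1,3,4) show ?thesis
    unfolding customary_monomial_def by blast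
qed

end
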